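(* If $y\in\mathcal{F}_\infty$ and $(p,q)\in\mathrm{Cyc}_{\mathbb{P}}(y)$, then $$(x_p+x_q)\,\hat{\mathfrak{S}}^{\mathtt{FPF}}_y=\sum_{z\in\hat\Psi^+(y,q)}\hat{\mathfrak{S}}^{\mathtt{FPF}}_z-\sum_{z\in\hat\Psi^-(y,p)}\hat{\mathfrak{S}}^{\mathtt{FPF}}_z,$$ where we set $\hat{\mathfrak{S}}^{\mathtt{FPF}}_z=0$ for $z\in\mathcal{F}_{\mathbb{Z}}-\mathcal{F}_\infty$.
   Context: $S_{\mathbb{Z}}$ is the group of permutations of $\mathbb{Z}$ fixing all but finitely many integers, $\mathbb{P}=\{1,2,3,\dots\}$, $S_\infty$ is the subgroup of elements with support contained in $\mathbb{P}$, $S_n\subset S_\infty$ the subgroup fixing all integers outside $\{1,\dots,n\}$. Products are compositions; $(i,j)$ denotes a transposition; $s_i=(i,i+1)$; $\ell(w)$ is the number of pairs $i<j$ with $w(i)>w(j)$. Let $\Theta:\mathbb{Z}\to\mathbb{Z}$, $\Theta(i)=i-(-1)^i$. $\mathcal{F}_\infty$ and $\mathcal{F}_{\mathbb{Z}}$ are the sets of conjugates $w^{-1}\Theta w$ with $w\in S_\infty$ and $w\in S_{\mathbb{Z}}$, respectively. For $z\in\mathcal{F}_{\mathbb{Z}}$: $\mathrm{Inv}(z)=\{(i,j)\in\mathbb{Z}\times\mathbb{Z}: i<j,\ z(i)>z(j)\}$, $\mathrm{Cyc}_{\mathbb{Z}}(z)=\{(i,j)\in\mathbb{Z}\times\mathbb{Z}: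 i\le j=z(i)\}$, $\mathrm{Cyc}_{\mathbb{P}}(z)=\mathrm{Cyc}_{\mathbb{Z}}(z)\cap(\mathbb{P}\times\mathbb{P})$, and $\hat\ell_{\mathtt{FPF}}(z)=\frac12|\mathrm{Inv}(z)-\mathrm{Cyc}_{\mathbb{Z}}(z)|$ (a finite nonnegative integer). The Bruhat order $<$ on $\mathcal{F}_{\mathbb{Z}}$ is the weakest partial order with $z<tzt$ whenever $z\in\mathcal{F}_{\mathbb{Z}}$ and $t\in S_{\mathbb{Z}}$ is a transposition with $\hat\ell_{\mathtt{FPF}}(z)<\hat\ell_{\mathtt{FPF}}(tzt)$. Write $y\lessdot_{\mathcal{F}}z$ if $\{y\}=\{w\in\mathcal{F}_{\mathbb{Z}}: y\le w<z\}$. For $y\in\mathcal{F}_{\mathbb{Z}}$, $r\in\mathbb{Z}$: $\hat\Psi^+(y,r)=\{z\in\mathcal{F}_{\mathbb{Z}}: y\lessdot_{\mathcal{F}}z$ and $z=(r,j)y(r,j)$ for an integer $j>r\}$, $\hat\Psi^-(y,r)=\{z\in\mathcal{F}_{\mathbb{Z}}: y\lessdot_{\mathcal{F}}z$ and $z=(i,r)y(i,r)$ for an integer $i<r\}$. Schubert polynomials: $S_\infty$ acts on $\mathbb{Z}[x_1,x_2,\dots]$ by permuting variables; $\partial_if=(f-s_if)/(x_i-x_{i+1})$ for $i\in\mathbb{P}$; $\partial_w=\partial_{i_1}\cdots\partial_{i_k}$ for any reduced word $w=s_{i_1}\cdots s_{i_k}$, $k=\ell(w)$. For $v\in S_n$,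 $\mathfrak{S}_v=\partial_{v^{-1}w_n}(x_1^{n-1}x_2^{n-2}\cdots x_{n-1})$ where $w_n=n\cdots321$; this is independent of $n$. For $z\in\mathcal{F}_{\mathbb{Z}}$, $\mathcal{A}_{\mathtt{FPF}}(z)$ is the set of $w\in S_{\mathbb{Z}}$ of minimal length with $z=w^{-1}\Theta w$. For $z\in\mathcal{F}_\infty$, $\hat{\mathfrak{S}}^{\mathtt{FPF}}_z=\sum_{w\in\mathcal{A}_{\mathtt{FPF}}(z)}\mathfrak{S}_w$. *)

theory Defs
  imports Complex_Main "HOL-Library.Poly_Mapping" "HOL-Combinatorics.Permutations"
begin

section \<open>Permutations of the integers\<close>

definition S_Z :: "(int \<Rightarrow> int) set" where
  "S_Z = {w. bij w \<and> finite {i. w i \<noteq> i}}"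

definition S_inf :: "(int \<Rightarrow> int) set" where
  "S_inf = {w \<in> S_Z. {i. w i \<noteq> i} \<subseteq> {1..}}"

definition S_fin :: "nat \<Rightarrow> (int \<Rightarrow> int) set" where
  "S_fin n = {w. w permutes {1..int n}}"

definition len :: "(int \<Rightarrow> int) \<Rightarrow> nat" where
  "len w = card {(i, j). i < j \<and> w i > w j}"

definition simple :: "int \<Rightarrow> int \<Rightarrow> int" where
  "simple i = transpose i (i + 1)"

definition longest :: "nat \<Rightarrow> int \<Rightarrow> int" where
  "longest n = (\<lambda>i. if 1 \<le> i \<and> i \<le> int n then int n + 1 - i else i)"

text \<open>\<open>[i\<^sub>1, \<dots>, i\<^sub>k]\<close> is a reduced word of \<open>s\<^bsub>i\<^sub>1\<^esub> \<circ> \<dots> \<circ> s\<^bsub>i\<^sub>k\<^esub>\<close>.\<close>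

definition reduced_word :: "int list \<Rightarrow> (int \<Rightarrow> int) \<Rightarrow> bool" where
  "reduced_word a w \<longleftrightarrow>
     (\<forall>i\<in>set a. 1 \<le> i) \<and> w = foldr (\<lambda>i u. simple i \<circ> u) a id \<and> length a = len w"

section \<open>Schubert polynomials\<close>

text \<open>Polynomials are finitely supported maps from monomials (finitely supported
  exponent functions) to integer coefficients. For uniformity the variables are indexed by all
  integers; the polynomials under consideration only involve \<open>x\<^sub>1, x\<^sub>2, \<dots>\<close>.\<close>

type_synonym zpoly = "(int \<Rightarrow>\<^sub>0 nat) \<Rightarrow>\<^sub>0 int"

definition X :: "int \<Rightarrow> zpoly" where
  "X i = Poly_Mapping.single (Poly_Mapping.single i 1) 1"

text \<open>The substitution \<open>x\<^sub>i \<mapsto> x\<^bsub>w(i)\<^esub>\<close>.\<close>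

definition act :: "(int \<Rightarrow> int) \<Rightarrow> zpoly \<Rightarrow> zpoly" where
  "act w f = (\<Sum>m\<in>Poly_Mapping.keys f. of_int (Poly_Mapping.lookup f m) *
      (\<Prod>i\<in>Poly_Mapping.keys m. X (w i) ^ Poly_Mapping.lookup m i))"

text \<open>The quotient \<open>(f - s\<^sub>i f) / (x\<^sub>i - x\<^bsub>i+1\<^esub>)\<close>; there is at most one since
  \<^typ>\<open>zpoly\<close> is an integral domain.\<close>

definition ddiff :: "int \<Rightarrow> zpoly \<Rightarrow> zpoly" where
  "ddiff i f = (THE g. (X i - X (i + 1)) * g = f - act (simple i) f)"

text \<open>The divided difference of a permutation in \<^const>\<open>S_inf\<close>. The operator does not depend
  on the choice of the reduced word.\<close>

definition ddiff_perm :: "(int \<Rightarrow> int) \<Rightarrow> zpoly \<Rightarrow> zpoly" where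
  "ddiff_perm w = foldr ddiff (SOME a. reduced_word a w)"

definition schubert_n :: "nat \<Rightarrow> (int \<Rightarrow> int) \<Rightarrow> zpoly" where
  "schubert_n n v = ddiff_perm (inv v \<circ> longest n) (\<Prod>i\<in>{1..<n}. X (int i) ^ (n - i))"

text \<open>For \<open>v\<close> in \<^const>\<open>S_inf\<close>; \<^term>\<open>schubert_n n v\<close> is the same for all \<open>n\<close> with
  \<^prop>\<open>v \<in> S_fin n\<close>.\<close>

definition schubert :: "(int \<Rightarrow> int) \<Rightarrow> zpoly" where
  "schubert v = schubert_n (LEAST n. v \<in> S_fin n) v"

section \<open>Fixed-point-free involutions\<close>

text \<open>\<open>Theta i = i - (-1)\<^sup>i\<close>\<close>

definition Theta :: "int \<Rightarrow> int" where
  "Theta i = (if even i then i - 1 else i + 1)"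

definition F_inf :: "(int \<Rightarrow> int) set" where
  "F_inf = {inv w \<circ> Theta \<circ> w | w. w \<in> S_inf}"

definition F_Z :: "(int \<Rightarrow> int) set" where
  "F_Z = {inv w \<circ> Theta \<circ> w | w. w \<in> S_Z}"

definition Inv :: "(int \<Rightarrow> int) \<Rightarrow> (int \<times> int) set" where
  "Inv z = {(i, j). i < j \<and> z i > z j}"

definition Cyc_Z :: "(int \<Rightarrow> int) \<Rightarrow> (int \<times> int) set" where
  "Cyc_Z z = {(i, j). i \<le> j \<and> j = z i}"

definition Cyc_P :: "(int \<Rightarrow> int) \<Rightarrow> (int \<times> int) set" where
  "Cyc_P z = Cyc_Z z \<inter> ({1..} \<times> {1..})"

definition fpf_len :: "(int \<Rightarrow> int) \<Rightarrow> rat" where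
  "fpf_len z = of_nat (card (Inv z - Cyc_Z z)) / 2"

definition conj_transp :: "int \<Rightarrow> int \<Rightarrow> (int \<Rightarrow> int) \<Rightarrow> int \<Rightarrow> int" where
  "conj_transp i j z = transpose i j \<circ> z \<circ> transpose i j"

section \<open>Bruhat order\<close>

definition bruhat_step :: "(int \<Rightarrow> int) \<Rightarrow> (int \<Rightarrow> int) \<Rightarrow> bool" where
  "bruhat_step y z \<longleftrightarrow>
     y \<in> F_Z \<and> (\<exists>i j. i \<noteq> j \<and> z = conj_transp i j y) \<and> fpf_len y < fpf_len z"

text \<open>The least transitive relation containing the steps. It is irreflexive, hence the weakest
  strict partial order containing the steps.\<close>

definition bruhat_less :: "(int \<Rightarrow> int) \<Rightarrow> (int \<Rightarrow> int) \<Rightarrow> bool" where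
  "bruhat_less = bruhat_step\<^sup>+\<^sup>+"

lemma bruhat_less_fpf_len: "bruhat_less y z \<Longrightarrow> fpf_len y < fpf_len z"
  unfolding bruhat_less_def
  by (induction rule: tranclp_induct) (auto simp: bruhat_step_def)

lemma bruhat_less_irrefl: "\<not> bruhat_less z z"
  using bruhat_less_fpf_len by blast

definition bruhat_le :: "(int \<Rightarrow> int) \<Rightarrow> (int \<Rightarrow> int) \<Rightarrow> bool" where
  "bruhat_le y z \<longleftrightarrow> y = z \<or> bruhat_less y z"

definition bruhat_cover :: "(int \<Rightarrow> int) \<Rightarrow> (int \<Rightarrow> int) \<Rightarrow> bool" where
  "bruhat_cover y z \<longleftrightarrow> {y} = {w \<in> F_Z. bruhat_le y w \<and> bruhat_less w z}"

definition Psi_plus :: "(int \<Rightarrow> int) \<Rightarrow> int \<Rightarrow> (int \<Rightarrow> int) set" where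
  "Psi_plus y r = {z \<in> F_Z. bruhat_cover y z \<and> (\<exists>j>r. z = conj_transp r j y)}"

definition Psi_minus :: "(int \<Rightarrow> int) \<Rightarrow> int \<Rightarrow> (int \<Rightarrow> int) set" where
  "Psi_minus y r = {z \<in> F_Z. bruhat_cover y z \<and> (\<exists>i<r. z = conj_transp i r y)}"

section \<open>FPF involution Schubert polynomials\<close>

definition A_FPF :: "(int \<Rightarrow> int) \<Rightarrow> (int \<Rightarrow> int) set" where
  "A_FPF z = {w \<in> S_Z. z = inv w \<circ> Theta \<circ> w \<and>
     (\<forall>v\<in>S_Z. z = inv v \<circ> Theta \<circ> v \<longrightarrow> len w \<le> len v)}"

definition fpf_schubert :: "(int \<Rightarrow> int) \<Rightarrow> zpoly" where
  "fpf_schubert z = (if z \<in> F_inf then \<Sum>w\<in>A_FPF z. schubert w else 0)"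

end

theory Submission
  imports Defs
begin

text \<open>The formula is proved by comparing divided differences. A polynomial in \<open>x\<^sub>1, x\<^sub>2, \<dots>\<close> that
  vanishes at the origin and is annihilated by every \<open>ddiff a\<close> with \<open>a \<ge> 1\<close> is symmetric in
  infinitely many variables and therefore zero (\<open>vanishing_ddiff_imp_0\<close>). Both sides of the
  formula vanish at the origin, and the difference of the two sides turns out to be annihilated,
  by induction on the length of \<open>y\<close>.

  On polynomials the following is needed: for a descent \<open>z(a) > z(a + 1) \<noteq> a\<close> one has
  \<open>ddiff a (fpf_schubert z) = fpf_schubert (s z s)\<close> with \<open>s = simple a\<close>, and otherwise the divided
  difference is zero (\<open>ddiff_fpf_schubert\<close>). It follows from the same rule for ordinary Schubert
  polynomials (\<open>ddiff_schubert\<close>), as atoms are the \<open>w\<close> with \<open>z = inv w \<circ> Theta \<circ> w\<close> whose length is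
  that of \<open>z\<close>.

  The rest is combinatorics of the Bruhat order. If \<open>t = (i, j)\<close> with \<open>i < j\<close>, then \<open>t y t\<close> is longer
  than \<open>y\<close> iff \<open>y(i) < y(j)\<close> (\<open>flen_conj_less_iff\<close>). This criterion is almost invariant under
  conjugation by \<open>s\<close>, which gives a lifting property (\<open>flen_conj_lift\<close>). Lifting shows that the
  order is graded by the length (\<open>bruhat_cover_iff\<close>), and it matches the covers of \<open>y\<close> having a
  descent at \<open>a\<close> with the covers of \<open>s y s\<close> other than \<open>y\<close> (\<open>covers_descent_bij\<close>).

  Finally, the two sums over \<open>Psi_plus\<close> and \<open>Psi_minus\<close> run over the covers \<open>z\<close> that move both partners
  \<open>p\<close> and \<open>q\<close> up, respectively down. Hence twice their difference is the sum of
  \<open>sgn (z(p) - y(p)) + sgn (z(q) - y(q))\<close> times \<open>fpf_schubert z\<close> over all covers \<open>z\<close>. In this form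
  each partner may be treated separately (\<open>cover_sum\<close>). Under \<open>ddiff a\<close> the sum for \<open>y\<close> becomes the
  sum for \<open>s y s\<close> if \<open>a\<close> is a descent of \<open>y\<close>, and zero otherwise, up to one multiple of
  \<open>fpf_schubert y\<close>. This term arises because one of \<open>y\<close> and \<open>s y s\<close> covers the other, and for both
  partners together it is what the Leibniz rule yields when \<open>ddiff a\<close> is applied to \<open>X p + X q\<close>.\<close>

section \<open>Substitution of variables\<close>

definition mon_image :: "(int \<Rightarrow> int) \<Rightarrow> (int \<Rightarrow>\<^sub>0 nat) \<Rightarrow> zpoly" where
  "mon_image w m = (\<Prod>i\<in>Poly_Mapping.keys m. X (w i) ^ Poly_Mapping.lookup m i)"

lemma mon_image_superset:
  assumes "finite S" "Poly_Mapping.keys m \<subseteq> S"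
  shows "mon_image w m = (\<Prod>i\<in>S. X (w i) ^ Poly_Mapping.lookup m i)"
  unfolding mon_image_def
  by (rule prod.mono_neutral_left) (use assms in \<open>auto simp: in_keys_iff\<close>)

lemma mon_image_add: "mon_image w (m + n) = mon_image w m * mon_image w n"
proof -
  let ?S = "Poly_Mapping.keys m \<union> Poly_Mapping.keys n"
  have "mon_image w (m + n) = (\<Prod>i\<in>?S. X (w i) ^ Poly_Mapping.lookup (m + n) i)"
    by (rule mon_image_superset) (auto simp: keys_add)
  also have "\<dots> = mon_image w m * mon_image w n"
    by (simp add: mon_image_superset[of ?S] lookup_add power_add prod.distrib)
  finally show ?thesis .
qed

lemma act_superset:
  assumes "finite S" "Poly_Mapping.keys f \<subseteq> S"
  shows "act w f = (\<Sum>m\<in>S. of_int (Poly_Mapping.lookup f m) * mon_image w m)"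
  unfolding act_def mon_image_def[symmetric]
  by (rule sum.mono_neutral_left) (use assms in \<open>auto simp: in_keys_iff\<close>)

lemma act_add: "act w (f + g) = act w f + act w g"
proof -
  let ?S = "Poly_Mapping.keys f \<union> Poly_Mapping.keys g"
  have "act w (f + g) = (\<Sum>m\<in>?S. of_int (Poly_Mapping.lookup (f + g) m) * mon_image w m)"
    by (rule act_superset) (auto simp: keys_add)
  also have "\<dots> = act w f + act w g"
    by (simp add: act_superset[of ?S] lookup_add sum.distrib distrib_right)
  finally show ?thesis .
qed

lemma act_zero [simp]: "act w 0 = 0"
  by (simp add: act_def)

lemma act_sum: "act w (sum h I) = (\<Sum>i\<in>I. act w (h i))"
  by (induction I rule: infinite_finite_induct) (auto simp: act_add)

lemma act_single: "act w (Poly_Mapping.single m c) = of_int c * mon_image w m"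
  by (subst act_superset[of "{m}"]) (auto split: if_splits)

lemma sum_of_terms:
  fixes f :: zpoly
  shows "f = (\<Sum>m\<in>Poly_Mapping.keys f. Poly_Mapping.single m (Poly_Mapping.lookup f m))"
proof (rule poly_mapping_eqI)
  fix k
  show "Poly_Mapping.lookup f k = Poly_Mapping.lookup
      (\<Sum>m\<in>Poly_Mapping.keys f. Poly_Mapping.single m (Poly_Mapping.lookup f m)) k"
    by (auto simp: lookup_sum lookup_single when_def in_keys_iff)
qed

lemma act_mult: "act w (f * g) = act w f * act w g"
proof -
  let ?t = "\<lambda>f m. Poly_Mapping.single m (Poly_Mapping.lookup f m) :: zpoly"
  have one: "act w (?t f m * ?t g n) = act w (?t f m) * act w (?t g n)" for m n
    by (simp add: mult_single act_single mon_image_add)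
  have "act w (f * g) = act w ((\<Sum>m\<in>Poly_Mapping.keys f. ?t f m) * (\<Sum>n\<in>Poly_Mapping.keys g. ?t g n))"
    using sum_of_terms[of f] sum_of_terms[of g] by simp
  also have "\<dots> = (\<Sum>m\<in>Poly_Mapping.keys f. act w (?t f m)) * (\<Sum>n\<in>Poly_Mapping.keys g. act w (?t g n))"
    by (simp only: sum_product act_sum one)
  also have "\<dots> = act w f * act w g"
    by (simp only: act_sum[symmetric] sum_of_terms[symmetric])
  finally show ?thesis .
qed

lemma of_int_eq_single: "(of_int c :: zpoly) = Poly_Mapping.single 0 c"
proof -
  have "Poly_Mapping.single 0 c = (of_int c :: zpoly)"
    using single_of_int[of c, where ?'b = int] unfolding of_int_eq_id id_apply by (simp del: single_of_int)
  then show ?thesis by (rule sym)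
qed

lemma act_of_int [simp]: "act w (of_int c) = of_int c"
proof -
  have "act w (of_int c) = act w (Poly_Mapping.single 0 c)"
    by (simp only: of_int_eq_single)
  also have "\<dots> = of_int c"
    by (simp add: act_single mon_image_def)
  finally show ?thesis .
qed

lemma act_X [simp]: "act w (X i) = X (w i)"
  by (simp add: X_def act_single mon_image_def)

lemma act_one [simp]: "act w 1 = 1"
  using act_of_int[of w 1] by simp

lemma act_uminus: "act w (- f) = - act w f"
proof -
  have "act w (f + (- f)) = 0" by simp
  then show ?thesis unfolding act_add by (simp add: add_eq_0_iff)
qed

lemma act_diff: "act w (f - g) = act w f - act w g"
  using act_add[of w f "- g"] by (simp add: act_uminus)

lemma act_power: "act w (f ^ n) = act w f ^ n"
  by (induction n) (auto simp: act_mult)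

lemma act_prod: "act w (prod h I) = (\<Prod>i\<in>I. act w (h i))"
  by (induction I rule: infinite_finite_induct) (auto simp: act_mult)

lemmas act_hom = act_add act_diff act_mult act_uminus act_power act_prod act_sum

lemma X_power: "X i ^ k = Poly_Mapping.single (Poly_Mapping.single i k) 1"
proof (induction k)
  case (Suc k)
  then show ?case by (simp add: X_def mult_single single_add[symmetric])
qed simp

lemma term_eq: "Poly_Mapping.single m c = of_int c * mon_image id m"
proof -
  have prod_single: "(\<Prod>i\<in>I. Poly_Mapping.single (h i) 1) = (Poly_Mapping.single (\<Sum>i\<in>I. h i) 1 :: zpoly)"
    if "finite I" for I :: "int set" and h :: "int \<Rightarrow> int \<Rightarrow>\<^sub>0 nat"
    using that by induction (auto simp: mult_single)
  have m: "m = (\<Sum>i\<in>Poly_Mapping.keys m. Poly_Mapping.single i (Poly_Mapping.lookup m i))"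
    by (rule poly_mapping_eqI) (auto simp: lookup_sum lookup_single when_def in_keys_iff)
  have "mon_image id m = Poly_Mapping.single m 1"
    unfolding mon_image_def X_power id_apply by (subst prod_single) (auto simp: m[symmetric])
  then show ?thesis
    by (simp add: of_int_eq_single mult_single)
qed

text \<open>To compare ring homomorphisms, or to divide by \<open>X i - X (i + 1)\<close>, it suffices to look at
  constants and variables.\<close>

lemma zpoly_induct [case_names const X add mult]:
  assumes "\<And>c. P (of_int c)" "\<And>i. P (X i)"
    and "\<And>f g. P f \<Longrightarrow> P g \<Longrightarrow> P (f + g)" and "\<And>f g. P f \<Longrightarrow> P g \<Longrightarrow> P (f * g)"
  shows "P f"
proof -
  have pow: "P (X i ^ k)" for i k
    using assms(1)[of 1] by (induction k) (auto intro: assms)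
  have pr: "P (mon_image id m)" for m
    unfolding mon_image_def using finite_keys[of m]
    by (induction rule: finite_induct) (use assms(1)[of 1] in \<open>auto intro: assms pow\<close>)
  have mono: "P (Poly_Mapping.single m c)" for m c
    unfolding term_eq by (intro assms pr)
  have "P (\<Sum>m\<in>M. Poly_Mapping.single m (Poly_Mapping.lookup f m))" if "finite M" for M
    using that by induction (use assms(1)[of 0] in \<open>auto intro: assms mono\<close>)
  then show ?thesis using sum_of_terms[of f] finite_keys[of f] by metis
qed

lemma act_comp: "act v (act w f) = act (v \<circ> w) f"
  by (induction f rule: zpoly_induct) (auto simp: act_hom)

lemma act_id [simp]: "act id f = f"
  by (induction f rule: zpoly_induct) (auto simp: act_hom)

section \<open>Divided differences\<close>

lemma simple_simps [simp]:
  "simple a a = a + 1" "simple a (a + 1) = a" "simple a \<circ> simple a = id"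
  "simple a (simple a i) = i"
  by (auto simp: simple_def fun_eq_iff)

lemma X_eq_iff [simp]: "X i = X j \<longleftrightarrow> i = j"
proof
  assume "X i = X j"
  then have "Poly_Mapping.lookup (X i) (Poly_Mapping.single i 1) = Poly_Mapping.lookup (X j) (Poly_Mapping.single i 1)"
    by simp
  then have "Poly_Mapping.single i (1::nat) = Poly_Mapping.single j 1"
    unfolding X_def lookup_single by (simp add: when_def split: if_splits)
  then have "Poly_Mapping.lookup (Poly_Mapping.single i (1::nat)) i = Poly_Mapping.lookup (Poly_Mapping.single j 1) i"
    by simp
  then show "i = j" by (simp add: lookup_single when_def split: if_splits)
qed simp

text \<open>By the twisted Leibniz rule divisibility passes to products, so that only the variables have to
  be checked.\<close>

lemma ddiff_exists: "\<exists>g. (X i - X (i + 1)) * g = f - act (simple i) f"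
proof (induction f rule: zpoly_induct)
  case (const c)
  show ?case by (rule exI[of _ 0]) simp
next
  case (X j)
  show ?case
    by (rule exI[of _ "if j = i then 1 else if j = i + 1 then -1 else 0"])
      (auto simp: simple_def transpose_def)
next
  case (add f g)
  then obtain f' g' where "(X i - X (i + 1)) * f' = f - act (simple i) f"
    "(X i - X (i + 1)) * g' = g - act (simple i) g" by blast
  then show ?case
    by (intro exI[of _ "f' + g'"]) (simp add: act_hom distrib_left)
next
  case (mult f g)
  then obtain f' g' where "(X i - X (i + 1)) * f' = f - act (simple i) f"
    "(X i - X (i + 1)) * g' = g - act (simple i) g" by blast
  note fg = this
  have "(X i - X (i + 1)) * (f' * g + act (simple i) f * g')
    = ((X i - X (i + 1)) * f') * g + act (simple i) f * ((X i - X (i + 1)) * g')"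
    by (simp add: algebra_simps)
  also have "\<dots> = f * g - act (simple i) (f * g)"
    unfolding fg by (simp add: act_mult algebra_simps)
  finally show ?case by blast
qed

lemma ddiff_unique:
  assumes "(X i - X (i + 1)) * g = f - act (simple i) f"
  shows "ddiff i f = g"
  unfolding ddiff_def
proof (rule the_equality)
  show "(X i - X (i + 1)) * g = f - act (simple i) f" by (rule assms)
next
  fix h assume "(X i - X (i + 1)) * h = f - act (simple i) f"
  then have "(X i - X (i + 1)) * h = (X i - X (i + 1)) * g" using assms by simp
  then show "h = g" by simp
qed

lemma ddiff_mult_root: "(X i - X (i + 1)) * ddiff i f = f - act (simple i) f"
  using ddiff_exists[of i f] ddiff_unique by metis

lemma ddiff_add: "ddiff i (f + g) = ddiff i f + ddiff i g"
  by (rule ddiff_unique) (simp add: distrib_left ddiff_mult_root act_hom)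

lemma ddiff_eq_0_iff: "ddiff i f = 0 \<longleftrightarrow> act (simple i) f = f"
  using ddiff_mult_root[of i f] ddiff_unique[of i 0 f] by auto

lemma ddiff_of_int [simp]: "ddiff i (of_int c) = 0"
  by (simp add: ddiff_eq_0_iff)

lemma ddiff_zero [simp]: "ddiff i 0 = 0"
  by (simp add: ddiff_eq_0_iff)

lemma ddiff_mult: "ddiff i (f * g) = ddiff i f * g + act (simple i) f * ddiff i g"
proof (rule ddiff_unique)
  have "(X i - X (i + 1)) * (ddiff i f * g + act (simple i) f * ddiff i g)
    = ((X i - X (i + 1)) * ddiff i f) * g + act (simple i) f * ((X i - X (i + 1)) * ddiff i g)"
    by (simp add: algebra_simps)
  also have "\<dots> = f * g - act (simple i) (f * g)"
    unfolding ddiff_mult_root by (simp add: act_mult algebra_simps)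
  finally show "(X i - X (i + 1)) * (ddiff i f * g + act (simple i) f * ddiff i g)
      = f * g - act (simple i) (f * g)" .
qed

lemma ddiff_of_int_mult: "ddiff i (of_int c * f) = of_int c * ddiff i f"
  by (simp add: ddiff_mult)

lemma ddiff_diff: "ddiff i (f - g) = ddiff i f - ddiff i g"
  using ddiff_add[of i f "of_int (-1) * g"] ddiff_of_int_mult[of i "-1" g] by simp

lemma ddiff_sum: "ddiff i (sum h I) = (\<Sum>k\<in>I. ddiff i (h k))"
  by (induction I rule: infinite_finite_induct) (auto simp: ddiff_add)

lemma ddiff_X: "ddiff i (X j) = of_int ((if j = i then 1 else 0) - (if j = i + 1 then 1 else 0))"
  by (rule ddiff_unique) (auto simp: simple_def transpose_def)

lemma act_ddiff: "act (simple i) (ddiff i f) = ddiff i f"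
proof -
  have "act (simple i) ((X i - X (i + 1)) * ddiff i f) = act (simple i) (f - act (simple i) f)"
    by (simp add: ddiff_mult_root)
  then have "(X (i + 1) - X i) * act (simple i) (ddiff i f) = act (simple i) f - f"
    by (simp add: act_hom act_comp)
  also have "\<dots> = (X (i + 1) - X i) * ddiff i f"
    using ddiff_mult_root[of i f] by (simp add: algebra_simps)
  finally show ?thesis by simp
qed

lemma ddiff_ddiff [simp]: "ddiff i (ddiff i f) = 0"
  by (simp add: ddiff_eq_0_iff act_ddiff)

lemma simple_commute:
  assumes "\<bar>i - j\<bar> \<ge> 2"
  shows "simple i \<circ> simple j = simple j \<circ> simple i"
  using assms by (auto simp: fun_eq_iff simple_def transpose_def)

lemma simple_braid:
  "simple i \<circ> simple (i + 1) \<circ> simple i = simple (i + 1) \<circ> simple i \<circ> simple (i + 1)"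
proof
  fix x
  consider "x = i" | "x = i + 1" | "x = i + 2" | "x \<notin> {i, i + 1, i + 2}" by blast
  then show "(simple i \<circ> simple (i + 1) \<circ> simple i) x = (simple (i + 1) \<circ> simple i \<circ> simple (i + 1)) x"
    by cases (simp_all add: simple_def transpose_def)
qed

lemma ddiff_commute:
  assumes "\<bar>i - j\<bar> \<ge> 2"
  shows "ddiff i (ddiff j f) = ddiff j (ddiff i f)"
proof -
  have root: "act (simple i) (X j - X (j + 1)) = X j - X (j + 1)"
    "act (simple j) (X i - X (i + 1)) = X i - X (i + 1)"
    using assms by (auto simp: act_hom simple_def transpose_def)
  have *: "(X j - X (j + 1)) * ((X i - X (i + 1)) * ddiff i (ddiff j f))
      = f - act (simple j) f - act (simple i) f + act (simple i \<circ> simple j) f"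
    if "act (simple i) (X j - X (j + 1)) = X j - X (j + 1)" for i j
  proof -
    have "(X j - X (j + 1)) * ((X i - X (i + 1)) * ddiff i (ddiff j f))
      = (X j - X (j + 1)) * ddiff j f - act (simple i) (X j - X (j + 1)) * act (simple i) (ddiff j f)"
      unfolding ddiff_mult_root[of i] that by (rule right_diff_distrib)
    also have "\<dots> = (X j - X (j + 1)) * ddiff j f - act (simple i) ((X j - X (j + 1)) * ddiff j f)"
      by (simp only: act_mult)
    also have "\<dots> = f - act (simple j) f - act (simple i) f + act (simple i \<circ> simple j) f"
      unfolding ddiff_mult_root by (simp add: act_hom act_comp)
    finally show ?thesis .
  qed
  have "(X j - X (j + 1)) * ((X i - X (i + 1)) * ddiff i (ddiff j f))
    = (X i - X (i + 1)) * ((X j - X (j + 1)) * ddiff j (ddiff i f))"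
    unfolding *[OF root(1)] *[OF root(2)] simple_commute[OF assms] by simp
  also have "\<dots> = (X j - X (j + 1)) * ((X i - X (i + 1)) * ddiff j (ddiff i f))"
    by (rule mult.left_commute)
  finally show ?thesis by simp
qed

text \<open>Both sides of the braid relation are the antisymmetrisation of \<open>f\<close> over the symmetric
  group of the three indices, divided by the Vandermonde product.\<close>

lemma ddiff_braid:
  "ddiff i (ddiff (i + 1) (ddiff i f)) = ddiff (i + 1) (ddiff i (ddiff (i + 1) f))"
proof -
  let ?A = "X i - X (i + 1)" and ?B = "X (i + 1) - X (i + 2)" and ?C = "X i - X (i + 2)"
  let ?s = "act (simple i)" and ?r = "act (simple (i + 1))"
  have vals: "simple i (i + 2) = i + 2" "simple (i + 1) i = i" "simple (i + 1) (i + 2) = i + 1"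
    "simple (i + 1) (i + 1) = i + 2"
    by (auto simp: simple_def transpose_def)
  have sroot: "?s ?A = - ?A" "?s ?B = ?C" "?s ?C = ?B"
    and rroot: "?r ?A = ?C" "?r ?B = - ?B" "?r ?C = ?A"
    by (auto simp: act_hom vals)
  have A: "?A * ddiff i g = g - ?s g" for g by (rule ddiff_mult_root)
  have B: "?B * ddiff (i + 1) g = g - ?r g" for g
    using ddiff_mult_root[of "i + 1" g] by (simp add: add.assoc)
  have ss: "?s (?s g) = g" "?r (?r g) = g" for g by (auto simp: act_comp)
  have rsr: "?r (?s (?r f)) = ?s (?r (?s f))"
    using simple_braid[of i] by (simp add: act_comp comp_assoc)
  define P where "P = f - ?s f - ?r f + ?r (?s f) + ?s (?r f) - ?s (?r (?s f))"
  have 1: "?A * ?B * ?C * ddiff i (ddiff (i + 1) (ddiff i f)) = P"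
  proof -
    let ?g = "ddiff i f" let ?h = "ddiff (i + 1) ?g"
    have Ah: "?A * ddiff i ?h = ?h - ?s ?h" by (rule A)
    have Bh: "?B * ?h = ?g - ?r ?g" by (rule B)
    have Ch: "?C * ?s ?h = ?g - ?s (?r ?g)"
      using arg_cong[OF Bh, of ?s] by (simp only: act_mult act_diff[of "simple i" ?g] sroot act_ddiff)
    have Cg: "?C * ?r ?g = ?r f - ?r (?s f)"
      using arg_cong[OF A[of f], of ?r] by (simp only: act_mult act_diff[of "simple (i+1)" f] rroot)
    have Bg: "?B * ?s (?r ?g) = ?s (?r f) - ?s (?r (?s f))"
      using arg_cong[OF Cg, of ?s] by (simp only: act_mult act_diff[of "simple i" "?r f"] sroot)
    have "?A * ?B * ?C * ddiff i ?h = ?B * ?C * (?A * ddiff i ?h)" by (simp add: algebra_simps)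
    also have "\<dots> = ?C * (?B * ?h) - ?B * (?C * ?s ?h)" unfolding Ah by (simp add: algebra_simps)
    also have "\<dots> = (?C - ?B) * ?g - ?C * ?r ?g + ?B * ?s (?r ?g)"
      unfolding Bh Ch by (simp only: right_diff_distrib left_diff_distrib) simp
    also have "(?C - ?B) * ?g = f - ?s f" using A[of f] by simp
    finally show ?thesis unfolding Cg Bg P_def by simp
  qed
  have 2: "?A * ?B * ?C * ddiff (i + 1) (ddiff i (ddiff (i + 1) f)) = P"
  proof -
    let ?g = "ddiff (i + 1) f" let ?h = "ddiff i ?g"
    have Ah: "?B * ddiff (i + 1) ?h = ?h - ?r ?h" by (rule B)
    have Bh: "?A * ?h = ?g - ?s ?g" by (rule A)
    have Ch: "?C * ?r ?h = ?g - ?r (?s ?g)"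
      using arg_cong[OF Bh, of ?r] by (simp only: act_mult act_diff[of "simple (i+1)" ?g] rroot act_ddiff)
    have Cg: "?C * ?s ?g = ?s f - ?s (?r f)"
      using arg_cong[OF B[of f], of ?s] by (simp only: act_mult act_diff[of "simple i" f] sroot)
    have Bg: "?A * ?r (?s ?g) = ?r (?s f) - ?r (?s (?r f))"
      using arg_cong[OF Cg, of ?r] by (simp only: act_mult act_diff[of "simple (i+1)" "?s f"] rroot)
    have "?A * ?B * ?C * ddiff (i + 1) ?h = ?A * ?C * (?B * ddiff (i + 1) ?h)" by (simp add: algebra_simps)
    also have "\<dots> = ?C * (?A * ?h) - ?A * (?C * ?r ?h)" unfolding Ah by (simp add: algebra_simps)
    also have "\<dots> = (?C - ?A) * ?g - ?C * ?s ?g + ?A * ?r (?s ?g)"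
      unfolding Bh Ch by (simp only: right_diff_distrib left_diff_distrib) simp
    also have "(?C - ?A) * ?g = f - ?r f" using B[of f] by simp
    finally show ?thesis unfolding Cg Bg P_def rsr by simp
  qed
  have nz: "?A * ?B * ?C \<noteq> 0" by simp
  have "?A * ?B * ?C * ddiff i (ddiff (i + 1) (ddiff i f))
      = ?A * ?B * ?C * ddiff (i + 1) (ddiff i (ddiff (i + 1) f))"
    by (simp only: 1 2)
  with nz show ?thesis using mult_left_cancel by blast
qed

section \<open>Polynomials in the positive variables\<close>

definition in_vars :: "int set \<Rightarrow> zpoly \<Rightarrow> bool" where
  "in_vars V f \<longleftrightarrow> (\<forall>m\<in>Poly_Mapping.keys f. Poly_Mapping.keys m \<subseteq> V)"

lemma in_vars_add: "in_vars V f \<Longrightarrow> in_vars V g \<Longrightarrow> in_vars V (f + g)"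
  unfolding in_vars_def using keys_add[of f g] by blast

lemma in_vars_mult:
  assumes "in_vars V f" "in_vars V g"
  shows "in_vars V (f * g)"
  unfolding in_vars_def
proof
  fix m assume "m \<in> Poly_Mapping.keys (f * g)"
  then obtain a b where "m = a + b" "a \<in> Poly_Mapping.keys f" "b \<in> Poly_Mapping.keys g"
    using keys_mult[of f g] by blast
  then show "Poly_Mapping.keys m \<subseteq> V"
    using assms keys_add[of a b] unfolding in_vars_def by blast
qed

lemma in_vars_of_int: "in_vars V (of_int c)"
  by (simp add: of_int_eq_single in_vars_def)

lemma in_vars_X: "i \<in> V \<Longrightarrow> in_vars V (X i)"
  by (simp add: in_vars_def X_def)

lemma in_vars_power: "in_vars V f \<Longrightarrow> in_vars V (f ^ n)"
  using in_vars_of_int[of V 1] by (induction n) (auto intro: in_vars_mult)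

lemma in_vars_sum: "(\<And>i. i \<in> I \<Longrightarrow> in_vars V (h i)) \<Longrightarrow> in_vars V (sum h I)"
  using in_vars_of_int[of V 0] by (induction I rule: infinite_finite_induct) (auto intro: in_vars_add)

lemma in_vars_prod: "(\<And>i. i \<in> I \<Longrightarrow> in_vars V (h i)) \<Longrightarrow> in_vars V (prod h I)"
  using in_vars_of_int[of V 1] by (induction I rule: infinite_finite_induct) (auto intro: in_vars_mult)

lemma in_vars_act:
  assumes "in_vars V f"
  shows "in_vars (w ` V) (act w f)"
  unfolding act_def using assms unfolding in_vars_def[of V]
  by (intro in_vars_sum in_vars_mult in_vars_prod in_vars_power in_vars_X in_vars_of_int) blast

lemma in_vars_empty: "in_vars {} f \<Longrightarrow> Poly_Mapping.lookup f 0 = 0 \<Longrightarrow> f = 0"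
proof -
  assume "in_vars {} f" "Poly_Mapping.lookup f 0 = 0"
  then have "Poly_Mapping.keys f \<subseteq> {0}" "0 \<notin> Poly_Mapping.keys f"
    unfolding in_vars_def by (auto simp: in_keys_iff)
  then have "Poly_Mapping.keys f = {}" by blast
  then show ?thesis by simp
qed

text \<open>The polynomials in the positive variables that vanish at the origin; these are the sums of
  homogeneous polynomials of positive degree.\<close>

definition vanishing :: "zpoly \<Rightarrow> bool" where
  "vanishing f \<longleftrightarrow> in_vars {1..} f \<and> Poly_Mapping.lookup f 0 = 0"

lemma vanishing_add: "vanishing f \<Longrightarrow> vanishing g \<Longrightarrow> vanishing (f + g)"
  unfolding vanishing_def by (auto intro: in_vars_add simp: lookup_add)

lemma vanishing_0 [simp]: "vanishing 0"
  using in_vars_of_int[of _ 0] by (simp add: vanishing_def)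

lemma vanishing_mult:
  assumes "vanishing f" "in_vars {1..} g"
  shows "vanishing (g * f)"
proof -
  have "0 \<notin> Poly_Mapping.keys (g * f)"
  proof
    assume "0 \<in> Poly_Mapping.keys (g * f)"
    then obtain a b where ab: "0 = a + b" "b \<in> Poly_Mapping.keys f"
      using keys_mult[of g f] by blast
    have "Poly_Mapping.lookup b i = 0" for i
    proof -
      have "Poly_Mapping.lookup a i + Poly_Mapping.lookup b i = 0"
        unfolding lookup_add[symmetric] ab(1)[symmetric] by simp
      then show ?thesis by simp
    qed
    then have "b = 0" by (intro poly_mapping_eqI) simp
    with ab(2) assms(1) show False unfolding vanishing_def by (simp add: in_keys_iff)
  qed
  then show ?thesis using assms by (simp add: vanishing_def in_vars_mult in_keys_iff)
qed

lemma vanishing_of_int_mult: "vanishing f \<Longrightarrow> vanishing (of_int c * f)"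
  by (rule vanishing_mult) (auto simp: in_vars_of_int)

lemma vanishing_diff: "vanishing f \<Longrightarrow> vanishing g \<Longrightarrow> vanishing (f - g)"
  using vanishing_add[of f "of_int (-1) * g"] vanishing_of_int_mult[of g "-1"] by simp

lemma vanishing_sum: "(\<And>i. i \<in> I \<Longrightarrow> vanishing (h i)) \<Longrightarrow> vanishing (sum h I)"
  by (induction I rule: infinite_finite_induct) (auto intro: vanishing_add)

lemma vanishing_X: "1 \<le> i \<Longrightarrow> vanishing (X i)"
proof -
  assume i: "1 \<le> i"
  have "Poly_Mapping.lookup (Poly_Mapping.single i (1::nat)) i = 1" by simp
  then have ne: "Poly_Mapping.single i (1::nat) \<noteq> 0" by (metis lookup_zero zero_neq_one)
  have "Poly_Mapping.lookup (X i) 0 = 0"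
    unfolding X_def lookup_single using ne by (simp only: when_def if_False)
  then show "vanishing (X i)" unfolding vanishing_def using in_vars_X[of i "{1..}"] i by simp
qed

text \<open>If \<open>B\<close> were the largest index of a variable of \<open>f\<close>, invariance under \<open>simple B\<close> would
  make \<open>B + 1\<close> occur as well.\<close>

lemma vanishing_ddiff_imp_0:
  assumes "vanishing f" and "\<And>i. 1 \<le> i \<Longrightarrow> ddiff i f = 0"
  shows "f = 0"
proof -
  define W where "W = (\<Union>m\<in>Poly_Mapping.keys f. Poly_Mapping.keys m)"
  have fW: "finite W" by (simp add: W_def)
  have vW: "in_vars V f \<longleftrightarrow> W \<subseteq> V" for V
    unfolding in_vars_def W_def by (rule UN_subset_iff[symmetric])
  have f0: "in_vars {1..} f" "Poly_Mapping.lookup f 0 = 0"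
    using assms(1) unfolding vanishing_def by (rule conjunct1, rule conjunct2)
  have W1: "W \<subseteq> {1..}" by (rule vW[THEN iffD1, OF f0(1)])
  have "W = {}"
  proof (rule ccontr)
    assume "W \<noteq> {}"
    define B where "B = Max W"
    have B: "B \<in> W" "\<And>b. b \<in> W \<Longrightarrow> b \<le> B" 
      unfolding B_def using Max_in[OF fW \<open>W \<noteq> {}\<close>] Max_ge[OF fW] by blast+
    have "1 \<le> B" using B(1) W1 by auto
    then have "act (simple B) f = f" using assms(2) ddiff_eq_0_iff by blast
    then have "in_vars (simple B ` W) f"
      using in_vars_act[OF vW[THEN iffD2, OF subset_refl], of "simple B"] by (simp only:)
    then have "W \<subseteq> simple B ` W" by (rule vW[THEN iffD1])
    then obtain b where b: "b \<in> W" "simple B b = B" using B(1) by force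
    have "b = simple B (simple B b)" by simp
    also have "\<dots> = B + 1" unfolding b(2) by simp
    finally have "b = B + 1" .
    with b(1) B(2)[of b] show False by simp
  qed
  then have "in_vars {} f" by (intro vW[THEN iffD2]) simp
  then show ?thesis using f0(2) by (rule in_vars_empty)
qed

text \<open>Homogeneous polynomials in the positive variables. Generating them by multiplication with
  variables makes the Leibniz rule show at once that a divided difference lowers the degree by
  one.\<close>

inductive homogeneous :: "nat \<Rightarrow> zpoly \<Rightarrow> bool" where
  const: "homogeneous 0 (of_int c)"
| add: "homogeneous d f \<Longrightarrow> homogeneous d g \<Longrightarrow> homogeneous d (f + g)"
| X_mult: "1 \<le> i \<Longrightarrow> homogeneous d f \<Longrightarrow> homogeneous (Suc d) (X i * f)"

lemma homogeneous_0: "homogeneous d 0"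
proof (induction d)
  case 0
  then show ?case using homogeneous.const[of 0] by simp
next
  case (Suc d)
  then show ?case using homogeneous.X_mult[of 1 d 0] by simp
qed

lemma homogeneous_of_int_mult: "homogeneous d f \<Longrightarrow> homogeneous d (of_int c * f)"
proof (induction rule: homogeneous.induct)
  case (const c')
  then show ?case using homogeneous.const[of "c * c'"] by simp
next
  case (add d f g)
  then show ?case by (auto simp: distrib_left intro: homogeneous.intros)
next
  case (X_mult i d f)
  then show ?case using homogeneous.X_mult[of i d "of_int c * f"] by (simp add: mult.left_commute)
qed

lemma homogeneous_ddiff: "homogeneous d f \<Longrightarrow> 1 \<le> a \<Longrightarrow> homogeneous (d - 1) (ddiff a f)"
proof (induction rule: homogeneous.induct)
  case (const c)
  show ?case by (simp add: homogeneous_0)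
next
  case (add d f g)
  then show ?case by (auto simp: ddiff_add intro: homogeneous.intros)
next
  case (X_mult i d f)
  have "1 \<le> simple a i" using X_mult by (auto simp: simple_def transpose_def)
  have "homogeneous d (X (simple a i) * ddiff a f)"
  proof (cases d)
    case 0
    have "homogeneous e g \<Longrightarrow> e = 0 \<Longrightarrow> ddiff a g = 0" for e g
      by (induction e g rule: homogeneous.induct) (auto simp: ddiff_add)
    with 0 X_mult(2) have "ddiff a f = 0" by blast
    then show ?thesis by (simp add: homogeneous_0)
  next
    case (Suc d')
    then show ?thesis using X_mult \<open>1 \<le> simple a i\<close> by (auto intro: homogeneous.intros)
  qed
  then show ?case
    unfolding ddiff_mult ddiff_X act_X diff_Suc_1
    by (intro homogeneous.add homogeneous_of_int_mult) (use X_mult in auto)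
qed

lemma homogeneous_vars: "homogeneous d f \<Longrightarrow> in_vars {1..} f"
  by (induction rule: homogeneous.induct)
    (auto intro: in_vars_of_int in_vars_add in_vars_mult in_vars_X)

lemma homogeneous_vanishing: "homogeneous d f \<Longrightarrow> 0 < d \<Longrightarrow> vanishing f"
proof (induction rule: homogeneous.induct)
  case (X_mult i d f)
  then show ?case
    using vanishing_mult[OF vanishing_X[of i] homogeneous_vars[of d f]] by (simp add: mult.commute)
qed (auto intro: vanishing_add)

section \<open>Lengths of permutations\<close>

lemma S_Z_comp: "v \<in> S_Z \<Longrightarrow> w \<in> S_Z \<Longrightarrow> v \<circ> w \<in> S_Z"
proof -
  assume *: "v \<in> S_Z" "w \<in> S_Z"
  have "{i. (v \<circ> w) i \<noteq> i} \<subseteq> {i. v i \<noteq> i} \<union> {i. w i \<noteq> i}" by auto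
  with * show ?thesis unfolding S_Z_def using bij_comp finite_subset by blast
qed

lemma bij_simple [simp]: "bij (simple a)"
  by (rule o_bij[of "simple a"]) simp_all

lemma inv_simple [simp]: "inv (simple a) = simple a"
  by (rule inv_unique_comp) simp_all

lemma simple_other: "i \<noteq> a \<Longrightarrow> i \<noteq> a + 1 \<Longrightarrow> simple a i = i"
  by (simp add: simple_def)

lemma simple_S_Z [simp]: "simple a \<in> S_Z"
proof -
  have "{i. simple a i \<noteq> i} \<subseteq> {a, a + 1}" using simple_other by blast
  then show ?thesis unfolding S_Z_def using finite_subset by auto
qed

lemma id_S_Z [simp]: "id \<in> S_Z"
  by (simp add: S_Z_def)

lemma inv_S_Z: "w \<in> S_Z \<Longrightarrow> inv w \<in> S_Z"
proof -
  assume "w \<in> S_Z"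
  then have b: "bij w" and f: "finite {i. w i \<noteq> i}" by (auto simp: S_Z_def)
  have "{i. inv w i \<noteq> i} = {i. w i \<noteq> i}" using b by (metis bij_inv_eq_iff)
  with b f show ?thesis by (simp add: S_Z_def bij_imp_bij_inv)
qed

lemma S_Z_bij: "w \<in> S_Z \<Longrightarrow> bij w"
  by (simp add: S_Z_def)

lemma S_Z_neq: "w \<in> S_Z \<Longrightarrow> i \<noteq> j \<Longrightarrow> w i \<noteq> w j"
  using S_Z_bij bij_is_inj inj_eq by metis

lemma S_inf_comp: "v \<in> S_inf \<Longrightarrow> w \<in> S_inf \<Longrightarrow> v \<circ> w \<in> S_inf"
proof -
  assume *: "v \<in> S_inf" "w \<in> S_inf"
  have "{i. (v \<circ> w) i \<noteq> i} \<subseteq> {i. v i \<noteq> i} \<union> {i. w i \<noteq> i}" by auto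
  with * show ?thesis unfolding S_inf_def using S_Z_comp by blast
qed

lemma inv_S_inf: "w \<in> S_inf \<Longrightarrow> inv w \<in> S_inf"
proof -
  assume w: "w \<in> S_inf"
  then have "bij w" by (simp add: S_inf_def S_Z_bij)
  then have "{i. inv w i \<noteq> i} = {i. w i \<noteq> i}" by (metis bij_inv_eq_iff)
  with w show ?thesis by (simp add: S_inf_def inv_S_Z)
qed

lemma simple_S_inf [simp]: "1 \<le> a \<Longrightarrow> simple a \<in> S_inf"
  unfolding S_inf_def using simple_other[of _ a] by force

lemma id_S_inf [simp]: "id \<in> S_inf"
  by (simp add: S_inf_def)

lemma S_inf_S_Z: "w \<in> S_inf \<Longrightarrow> w \<in> S_Z"
  by (simp add: S_inf_def)

lemma S_Z_window:
  assumes "w \<in> S_Z"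
  obtains N where "N \<ge> 0" "\<And>i. \<bar>i\<bar> > N \<Longrightarrow> w i = i" "\<And>i. \<bar>i\<bar> \<le> N \<Longrightarrow> \<bar>w i\<bar> \<le> N"
proof -
  have f: "finite {i. w i \<noteq> i}" using assms by (simp add: S_Z_def)
  define N where "N = (\<Sum>i | w i \<noteq> i. \<bar>i\<bar>)"
  have 1: "w i = i" if "\<bar>i\<bar> > N" for i
  proof (rule ccontr)
    assume "w i \<noteq> i"
    then have "\<bar>i\<bar> \<le> N" unfolding N_def using f by (intro member_le_sum) auto
    with that show False by simp
  qed
  have 2: "\<bar>w i\<bar> \<le> N" if "\<bar>i\<bar> \<le> N" for i
  proof (rule ccontr)
    assume "\<not> \<bar>w i\<bar> \<le> N"
    then have "w (w i) = w i" using 1 by simp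
    then have "w i = i" using S_Z_neq[OF assms] by blast
    with that \<open>\<not> \<bar>w i\<bar> \<le> N\<close> show False by simp
  qed
  have "N \<ge> 0" unfolding N_def by (simp add: sum_nonneg)
  with 1 2 show ?thesis using that by blast
qed

definition invs :: "(int \<Rightarrow> int) \<Rightarrow> (int \<times> int) set" where
  "invs w = {(i, j). i < j \<and> w i > w j}"

lemma len_invs: "len w = card (invs w)"
  by (simp add: len_def invs_def)

lemma finite_invs: "w \<in> S_Z \<Longrightarrow> finite (invs w)"
proof -
  assume "w \<in> S_Z"
  then obtain N where N: "N \<ge> 0" "\<And>i. \<bar>i\<bar> > N \<Longrightarrow> w i = i" "\<And>i. \<bar>i\<bar> \<le> N \<Longrightarrow> \<bar>w i\<bar> \<le> N"
    using S_Z_window by blast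
  have "invs w \<subseteq> {-N..N} \<times> {-N..N}"
  proof
    fix x assume "x \<in> invs w"
    then obtain i j where x: "x = (i, j)" "i < j" "w i > w j" by (auto simp: invs_def)
    have "\<bar>i\<bar> \<le> N \<and> \<bar>j\<bar> \<le> N" using N(2)[of i] N(2)[of j] N(3)[of i] N(3)[of j] x by linarith
    then show "x \<in> {-N..N} \<times> {-N..N}" using x by auto
  qed
  then show ?thesis using finite_subset by blast
qed

text \<open>The only pair whose order \<open>simple a\<close> reverses is \<open>(a, a + 1)\<close> itself. All changes of length are
  computed from this.\<close>

lemma simple_strict_mono: "i < j \<Longrightarrow> (i, j) \<noteq> (a, a + 1) \<Longrightarrow> simple a i < simple a j"
  by (auto simp: simple_def transpose_def)

lemma simple_less_iff: "{i, j} \<noteq> {a, a + 1} \<Longrightarrow> simple a i < simple a j \<longleftrightarrow> i < j"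
proof -
  assume "{i, j} \<noteq> {a, a + 1}"
  then have "(i, j) \<noteq> (a, a + 1)" "(j, i) \<noteq> (a, a + 1)" by auto
  then show ?thesis using simple_strict_mono[of i j a] simple_strict_mono[of j i a]
    by (cases i j rule: linorder_cases) auto
qed

lemma invs_comp_simple:
  assumes "w a < w (a + 1)"
  shows "invs (w \<circ> simple a) = insert (a, a + 1) (map_prod (simple a) (simple a) ` invs w)"
proof (intro set_eqI)
  fix x :: "int \<times> int" obtain i j where x: "x = (i, j)" by (cases x)
  have im: "x \<in> map_prod (simple a) (simple a) ` invs w \<longleftrightarrow> (simple a i, simple a j) \<in> invs w"
  proof
    assume "(simple a i, simple a j) \<in> invs w"
    then have "map_prod (simple a) (simple a) (simple a i, simple a j) \<in> map_prod (simple a) (simple a) ` invs w"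
      by (rule imageI)
    then show "x \<in> map_prod (simple a) (simple a) ` invs w" by (simp add: x)
  qed (auto simp: x)
  show "x \<in> invs (w \<circ> simple a) \<longleftrightarrow> x \<in> insert (a, a + 1) (map_prod (simple a) (simple a) ` invs w)"
  proof (cases "{i, j} = {a, a + 1}")
    case True
    then show ?thesis unfolding insert_iff im using assms
      by (auto simp: x invs_def doubleton_eq_iff)
  next
    case False
    then show ?thesis unfolding insert_iff im using simple_less_iff[OF False]
      by (auto simp: x invs_def)
  qed
qed

lemma len_comp_simple:
  assumes "w \<in> S_Z" "w a < w (a + 1)"
  shows "len (w \<circ> simple a) = Suc (len w)"
proof -
  have inj: "inj_on (map_prod (simple a) (simple a)) (invs w)"
    by (rule inj_onI) (metis map_prod_simp prod.collapse prod.inject simple_simps(4))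
  have "(a, a + 1) \<notin> map_prod (simple a) (simple a) ` invs w"
  proof
    assume "(a, a + 1) \<in> map_prod (simple a) (simple a) ` invs w"
    then obtain i j where "(i, j) \<in> invs w" "simple a i = a" "simple a j = a + 1" by auto
    then have "i = a + 1" "j = a" using simple_simps(4)[of a i] simple_simps(4)[of a j] by auto
    with \<open>(i, j) \<in> invs w\<close> show False by (simp add: invs_def)
  qed
  then show ?thesis unfolding len_invs invs_comp_simple[OF assms(2)]
    using finite_invs[OF assms(1)] inj by (simp add: card_image)
qed

lemma len_comp_simple_desc:
  assumes "w \<in> S_Z" "w a > w (a + 1)"
  shows "len w = Suc (len (w \<circ> simple a))"
  using len_comp_simple[of "w \<circ> simple a" a] assms S_Z_comp[OF assms(1) simple_S_Z[of a]]
  by (simp add: comp_assoc)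

lemma no_descent_id:
  assumes "w \<in> S_Z" "\<And>a. w a < w (a + 1)"
  shows "w = id"
proof
  fix i
  obtain N where N: "N \<ge> 0" "\<And>i. \<bar>i\<bar> > N \<Longrightarrow> w i = i" using S_Z_window[OF assms(1)] by metis
  have 1: "w i \<ge> i" if "i \<ge> - N - 1" for i
    using that
  proof (induction i rule: int_ge_induct)
    case base
    then show ?case using N by simp
  next
    case (step i)
    then show ?case using assms(2)[of i] by simp
  qed
  have 2: "w i \<le> i" if "i \<le> N + 1" for i
    using that
  proof (induction i rule: int_le_induct)
    case base
    then show ?case using N by simp
  next
    case (step i)
    then show ?case using assms(2)[of "i - 1"] by simp
  qed
  show "w i = id i"
  proof (cases "\<bar>i\<bar> > N")
    case True
    then show ?thesis using N(2) by simp
  next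
    case False
    then have "i \<ge> - N - 1" "i \<le> N + 1" by auto
    then show ?thesis using 1 2 by force
  qed
qed

lemma descent_exists:
  assumes "w \<in> S_Z" "w \<noteq> id"
  obtains a where "w a > w (a + 1)"
  using no_descent_id[OF assms(1)] assms(2) S_Z_neq[OF assms(1)]
  by (metis add_cancel_right_right linorder_neqE_linordered_idom zero_neq_one)

lemma len_id [simp]: "len id = 0"
  unfolding len_def by (subst card_eq_0_iff) auto

lemma S_inf_fix: "w \<in> S_inf \<Longrightarrow> i \<le> 0 \<Longrightarrow> w i = i"
  unfolding S_inf_def by force

lemma S_inf_pos: "w \<in> S_inf \<Longrightarrow> 1 \<le> i \<Longrightarrow> 1 \<le> w i"
proof (rule ccontr)
  assume w: "w \<in> S_inf" "1 \<le> i" "\<not> 1 \<le> w i"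
  then have "w (w i) = w i" using S_inf_fix by simp
  then have "w i = i" using S_Z_neq[OF S_inf_S_Z[OF w(1)]] by blast
  with w show False by simp
qed

lemma S_inf_descent: "w \<in> S_inf \<Longrightarrow> w a > w (a + 1) \<Longrightarrow> 1 \<le> a"
  using S_inf_fix[of w a] S_inf_fix[of w "a + 1"] S_inf_pos[of w "a + 1"] by (cases "a + 1 \<le> 0") force+

text \<open>Removing descents, every permutation is built up from the identity.\<close>

lemma S_Z_induct [consumes 1, case_names id ascent]:
  assumes "w \<in> S_Z" and "P id"
    and "\<And>w a. w \<in> S_Z \<Longrightarrow> w a < w (a + 1) \<Longrightarrow> P w \<Longrightarrow> P (w \<circ> simple a)"
  shows "P w"
  using assms(1)
proof (induction "len w" arbitrary: w rule: less_induct)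
  case less
  show ?case
  proof (cases "w = id")
    case False
    then obtain a where a: "w a > w (a + 1)" using descent_exists[OF less(2)] by blast
    let ?v = "w \<circ> simple a"
    have v: "?v \<in> S_Z" using less(2) S_Z_comp by simp
    have "P ?v" using less(1)[OF _ v] len_comp_simple_desc[OF less(2) a] by simp
    then have "P (?v \<circ> simple a)" using assms(3)[OF v] a by simp
    then show ?thesis by (simp add: comp_assoc)
  qed (simp add: assms(2))
qed

lemma len_inv: "bij w \<Longrightarrow> len (inv w) = len w"
proof -
  assume b: "bij w"
  have w: "w (inv w i) = i" "inv w (w i) = i" for i using b by (auto simp: bij_inv_eq_iff surj_f_inv_f bij_is_surj bij_is_inj)
  have "bij_betw (\<lambda>(i, j). (w j, w i)) (invs w) (invs (inv w))"
    by (rule bij_betw_byWitness[of _ "\<lambda>(i, j). (inv w j, inv w i)"]) (auto simp: invs_def w)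
  then show ?thesis by (simp add: len_invs bij_betw_same_card)
qed

lemma inv_simple_comp: "bij w \<Longrightarrow> inv (simple a \<circ> w) = inv w \<circ> simple a"
  by (simp add: o_inv_distrib)

lemma len_simple_comp:
  assumes "w \<in> S_Z" "inv w a < inv w (a + 1)"
  shows "len (simple a \<circ> w) = Suc (len w)"
proof -
  have b: "bij w" "bij (simple a \<circ> w)" 
    using S_Z_bij[OF assms(1)] S_Z_bij[OF S_Z_comp[OF simple_S_Z assms(1)]] by auto
  have "len (simple a \<circ> w) = len (inv w \<circ> simple a)"
    using len_inv[OF b(2)] inv_simple_comp[OF b(1)] by simp
  also have "\<dots> = Suc (len (inv w))" by (rule len_comp_simple[OF inv_S_Z[OF assms(1)] assms(2)])
  finally show ?thesis by (simp add: len_inv b)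
qed

lemma simple_simple_comp: "simple a \<circ> (simple a \<circ> w) = w"
  by (simp add: comp_assoc[symmetric])

lemma len_simple_comp_desc:
  assumes "w \<in> S_Z" "inv w a > inv w (a + 1)"
  shows "len w = Suc (len (simple a \<circ> w))"
proof -
  have "inv (simple a \<circ> w) a < inv (simple a \<circ> w) (a + 1)"
    using assms inv_simple_comp[OF S_Z_bij[OF assms(1)]] by simp
  from len_simple_comp[OF S_Z_comp[OF simple_S_Z assms(1)] this] show ?thesis
    by (simp add: simple_simple_comp)
qed

lemma simple_comp_length:
  assumes "w \<in> S_Z"
  shows "len (simple a \<circ> w) = Suc (len w) \<and> inv w a < inv w (a + 1)
    \<or> len w = Suc (len (simple a \<circ> w)) \<and> inv w a > inv w (a + 1)"
proof (cases "inv w a" "inv w (a + 1)" rule: linorder_cases)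
  case equal
  then show ?thesis using S_Z_neq[OF inv_S_Z[OF assms], of a "a + 1"] by simp
qed (use len_simple_comp[OF assms] len_simple_comp_desc[OF assms] in auto)

section \<open>Reduced words\<close>

definition word_perm :: "int list \<Rightarrow> int \<Rightarrow> int" where
  "word_perm a = foldr (\<lambda>i u. simple i \<circ> u) a id"

lemma word_perm_simps [simp]: "word_perm [] = id" "word_perm (i # a) = simple i \<circ> word_perm a"
  by (simp_all add: word_perm_def)

lemma word_perm_append: "word_perm (a @ b) = word_perm a \<circ> word_perm b"
  by (induction a) (auto simp: comp_assoc)

lemma reduced_word_alt: "reduced_word a w \<longleftrightarrow> (\<forall>i\<in>set a. 1 \<le> i) \<and> w = word_perm a \<and> length a = len w"
  by (simp add: reduced_word_def word_perm_def)

lemma word_perm_S_inf: "\<forall>i\<in>set a. 1 \<le> i \<Longrightarrow> word_perm a \<in> S_inf"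
proof (induction a)
  case (Cons i a)
  then have "1 \<le> i" "word_perm a \<in> S_inf" by simp_all
  then show ?case unfolding word_perm_simps by (intro S_inf_comp simple_S_inf)
qed (unfold word_perm_simps, rule id_S_inf)

lemma reduced_word_S_inf: "reduced_word a w \<Longrightarrow> w \<in> S_inf"
  unfolding reduced_word_alt by (elim conjE) (simp only: word_perm_S_inf)

lemma len_word_perm: "\<forall>i\<in>set a. 1 \<le> i \<Longrightarrow> len (word_perm a) \<le> length a"
proof (induction a)
  case (Cons i a)
  then have a: "\<forall>i\<in>set a. 1 \<le> i" "len (word_perm a) \<le> length a" by auto
  show ?case
    unfolding word_perm_simps list.size
    using simple_comp_length[OF S_inf_S_Z[OF word_perm_S_inf[OF a(1)]], of i] a(2) by linarith
qed simp

lemma reduced_word_Cons: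
  "reduced_word (i # a) w \<longleftrightarrow> 1 \<le> i \<and> w \<in> S_Z \<and> inv w i > inv w (i + 1) \<and> reduced_word a (simple i \<circ> w)"
proof
  assume r: "reduced_word (i # a) w"
  then have a: "1 \<le> i" "\<forall>j\<in>set a. 1 \<le> j" "w = simple i \<circ> word_perm a" "len w = Suc (length a)"
    by (auto simp: reduced_word_alt)
  then have w: "simple i \<circ> w = word_perm a" by (simp add: simple_simple_comp)
  have "w \<in> S_Z" using r reduced_word_S_inf S_inf_S_Z by blast
  then show "1 \<le> i \<and> w \<in> S_Z \<and> inv w i > inv w (i + 1) \<and> reduced_word a (simple i \<circ> w)"
    using simple_comp_length[OF \<open>w \<in> S_Z\<close>, of i] len_word_perm[OF a(2)] a(1,2,4)
    unfolding w reduced_word_alt by (elim disjE) simp_all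
next
  assume r: "1 \<le> i \<and> w \<in> S_Z \<and> inv w i > inv w (i + 1) \<and> reduced_word a (simple i \<circ> w)"
  then have a: "\<forall>j\<in>set a. 1 \<le> j" "simple i \<circ> w = word_perm a" "length a = len (simple i \<circ> w)"
    unfolding reduced_word_alt by blast+
  have "w = simple i \<circ> word_perm a" unfolding a(2)[symmetric] by (rule simple_simple_comp[symmetric])
  moreover have "len w = Suc (length a)" using len_simple_comp_desc[of w i] r a(3) by simp
  ultimately show "reduced_word (i # a) w" using r a(1) by (simp add: reduced_word_alt)
qed

lemma reduced_word_append1:
  assumes "reduced_word a w" "1 \<le> k" "w k < w (k + 1)"
  shows "reduced_word (a @ [k]) (w \<circ> simple k)"
  using assms len_comp_simple[OF S_inf_S_Z[OF reduced_word_S_inf[OF assms(1)]] assms(3)]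
  by (auto simp: reduced_word_alt word_perm_append)

lemma reduced_word_exists: "w \<in> S_inf \<Longrightarrow> \<exists>a. reduced_word a w"
proof (induction "len w" arbitrary: w rule: less_induct)
  case less
  show ?case
  proof (cases "w = id")
    case True
    then show ?thesis by (intro exI[of _ "[]"]) (simp add: reduced_word_alt)
  next
    case False
    have w: "w \<in> S_Z" using less(2) S_inf_S_Z by blast
    obtain k where k: "w k > w (k + 1)" using descent_exists[OF w False] by blast
    then have k1: "1 \<le> k" using S_inf_descent less(2) by blast
    let ?v = "w \<circ> simple k"
    have "?v \<in> S_inf" using S_inf_comp less(2) k1 by simp
    then obtain a where "reduced_word a ?v"
      using less(1)[of ?v] len_comp_simple_desc[OF w k] by auto
    then have "reduced_word (a @ [k]) (?v \<circ> simple k)"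
      by (rule reduced_word_append1) (use k k1 in auto)
    then show ?thesis by (auto simp: comp_assoc)
  qed
qed

text \<open>Matsumoto's argument. Two reduced words of \<open>w\<close> starting with \<open>i\<close> and \<open>j\<close> are compared with two
  further ones that start with the two sides of a braid or commutation relation in \<open>i\<close> and \<open>j\<close> and
  agree afterwards. Words with the same first letter are handled by induction, and the relations
  hold for divided differences.\<close>

lemma foldr_ddiff_unique:
  assumes "reduced_word a w" "reduced_word b w"
  shows "foldr ddiff a f = foldr ddiff b f"
  using assms
proof (induction "len w" arbitrary: w a b rule: less_induct)
  case less
  note IH = less(1)
  have wZ: "w \<in> S_Z" using reduced_word_S_inf S_inf_S_Z less(2) by blast
  have braid: "foldr ddiff (i # a') f = foldr ddiff ((i + 1) # b') f"
    if r: "reduced_word (i # a') w" "reduced_word ((i + 1) # b') w" for i a' b'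
  proof -
    let ?j = "i + 1"
    note ra = r(1)[unfolded reduced_word_Cons] and rb = r(2)[unfolded reduced_word_Cons]
    have d: "inv w i > inv w (i + 1)" "inv w (i + 1) > inv w (i + 2)" "1 \<le> i"
      using ra rb by (auto simp: add.assoc)
    let ?u = "simple i \<circ> w" let ?v = "simple ?j \<circ> w"
    let ?x = "simple i \<circ> (simple ?j \<circ> ?u)"
    have Z: "?u \<in> S_Z" "?v \<in> S_Z" "simple ?j \<circ> ?u \<in> S_Z" "simple i \<circ> ?v \<in> S_Z" "?x \<in> S_Z"
      using S_Z_comp wZ by auto
    have x2: "?x = simple ?j \<circ> (simple i \<circ> ?v)"
      using simple_braid[of i] by (metis comp_assoc)
    have sv: "simple i (i + 2) = i + 2" "simple (i + 1) i = i" "simple (i + 1) (i + 2) = i + 1"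
      "simple (i + 1) (i + 1) = i + 2"
      by (auto simp: simple_def transpose_def)
    have iu: "inv ?u = inv w \<circ> simple i" "inv ?v = inv w \<circ> simple ?j"
      "inv (simple ?j \<circ> ?u) = inv w \<circ> simple i \<circ> simple ?j"
      "inv (simple i \<circ> ?v) = inv w \<circ> simple ?j \<circ> simple i"
      using inv_simple_comp[OF S_Z_bij[OF wZ]] inv_simple_comp[OF S_Z_bij[OF Z(1)]]
        inv_simple_comp[OF S_Z_bij[OF Z(2)]] by (simp_all add: comp_assoc)
    have xinf: "?x \<in> S_inf"
      using reduced_word_S_inf[OF r(1)] d(3) by (intro S_inf_comp) auto
    then obtain c where c: "reduced_word c ?x" using reduced_word_exists by blast
    have "reduced_word (?j # i # c) ?u"
      unfolding reduced_word_Cons using c d Z by (simp add: iu sv add.assoc)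
    then have 1: "foldr ddiff a' f = foldr ddiff (?j # i # c) f"
      using IH[of ?u a' "?j # i # c"] ra len_simple_comp_desc[OF wZ d(1)] by simp
    have "reduced_word (i # ?j # c) ?v"
      unfolding reduced_word_Cons using c d Z by (simp add: iu sv add.assoc x2)
    then have 2: "foldr ddiff b' f = foldr ddiff (i # ?j # c) f"
      using IH[of ?v b' "i # ?j # c"] rb len_simple_comp_desc[OF wZ, of ?j] by simp
    show ?thesis using ddiff_braid[of i "foldr ddiff c f"] by (simp add: 1 2)
  qed
  show ?case
  proof (cases a)
    case Nil
    then have "len w = 0" using less(2) by (simp add: reduced_word_alt)
    then have "b = []" using less(3) by (simp add: reduced_word_alt)
    with Nil show ?thesis by simp
  next
    case a: (Cons i a')
    then obtain j b' where b: "b = j # b'"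
      using less(2,3) by (cases b) (auto simp: reduced_word_alt)
    note ra = less(2)[unfolded a reduced_word_Cons] and rb = less(3)[unfolded b reduced_word_Cons]
    consider "i = j" | "j = i + 1" | "i = j + 1" | "\<bar>i - j\<bar> \<ge> 2" by linarith
    then show ?thesis
    proof cases
      case 1
      then show ?thesis
        using IH[of "simple i \<circ> w" a' b'] ra rb len_simple_comp_desc[OF wZ, of i] by (simp add: a b)
    next
      case 2
      then show ?thesis using braid less(2,3) a b by blast
    next
      case 3
      then show ?thesis using braid[of j b' a'] less(2,3) a b by simp
    next
      case 4
      let ?u = "simple i \<circ> w" let ?v = "simple j \<circ> w" let ?x = "simple j \<circ> ?u"
      have Z: "?u \<in> S_Z" "?v \<in> S_Z" "?x \<in> S_Z" using S_Z_comp wZ by auto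
      have x2: "?x = simple i \<circ> ?v" using simple_commute[OF 4] by (metis comp_assoc)
      have iu: "inv ?u = inv w \<circ> simple i" "inv ?v = inv w \<circ> simple j"
        using inv_simple_comp[OF S_Z_bij[OF wZ]] by auto
      have sv: "simple i j = j" "simple i (j + 1) = j + 1" "simple j i = i" "simple j (i + 1) = i + 1"
        using 4 by (auto intro!: simple_other)
      have "?x \<in> S_inf"
        using reduced_word_S_inf[OF less(2)] ra rb by (intro S_inf_comp) auto
      then obtain c where c: "reduced_word c ?x" using reduced_word_exists by blast
      have "reduced_word (j # c) ?u"
        unfolding reduced_word_Cons using c rb Z by (simp add: iu sv)
      then have 1: "foldr ddiff a' f = foldr ddiff (j # c) f"
        using IH[of ?u a' "j # c"] ra len_simple_comp_desc[OF wZ, of i] by simp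
      have "reduced_word (i # c) ?v"
        unfolding reduced_word_Cons using c ra Z by (simp add: iu sv x2)
      then have 2: "foldr ddiff b' f = foldr ddiff (i # c) f"
        using IH[of ?v b' "i # c"] rb len_simple_comp_desc[OF wZ, of j] by simp
      show ?thesis using ddiff_commute[OF 4, of "foldr ddiff c f"] by (simp add: a b 1 2)
    qed
  qed
qed

lemma ddiff_perm_eq: "reduced_word a w \<Longrightarrow> ddiff_perm w f = foldr ddiff a f"
  unfolding ddiff_perm_def by (rule foldr_ddiff_unique[OF someI])

lemma ddiff_perm_simple_comp:
  assumes "u \<in> S_inf" "1 \<le> i" "inv u i < inv u (i + 1)"
  shows "ddiff_perm (simple i \<circ> u) f = ddiff i (ddiff_perm u f)"
proof -
  obtain a where a: "reduced_word a u" using reduced_word_exists assms(1) by blast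
  have "reduced_word (i # a) (simple i \<circ> u)"
    unfolding reduced_word_Cons using a assms inv_simple_comp[OF S_Z_bij[OF S_inf_S_Z[OF assms(1)]]]
      S_Z_comp[OF simple_S_Z S_inf_S_Z[OF assms(1)]]
    by (simp add: simple_simple_comp)
  from ddiff_perm_eq[OF this] ddiff_perm_eq[OF a] show ?thesis by simp
qed

lemma ddiff_ddiff_perm_eq_0:
  assumes "u \<in> S_inf" "1 \<le> i" "inv u i > inv u (i + 1)"
  shows "ddiff i (ddiff_perm u f) = 0"
proof -
  have "simple i \<circ> u \<in> S_inf" using assms S_inf_comp by simp
  then have "ddiff_perm (simple i \<circ> (simple i \<circ> u)) f = ddiff i (ddiff_perm (simple i \<circ> u) f)"
    by (rule ddiff_perm_simple_comp)
      (use assms inv_simple_comp[OF S_Z_bij[OF S_inf_S_Z[OF assms(1)]]] in auto)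
  then show ?thesis by (simp add: simple_simple_comp)
qed

section \<open>Schubert polynomials under divided differences\<close>

lemma S_fin_S_inf: "w \<in> S_fin n \<Longrightarrow> w \<in> S_inf"
proof -
  assume "w \<in> S_fin n"
  then have w: "w permutes {1..int n}" by (simp add: S_fin_def)
  then have "{i. w i \<noteq> i} \<subseteq> {1..int n}" using permutes_not_in[OF w] by blast
  moreover from this have "finite {i. w i \<noteq> i}" using finite_subset by blast
  ultimately show ?thesis using permutes_bij[OF w] unfolding S_inf_def S_Z_def by auto
qed

lemma S_inf_S_fin:
  assumes "w \<in> S_inf"
  obtains n where "w \<in> S_fin n"
proof -
  have wZ: "w \<in> S_Z" using assms by (rule S_inf_S_Z)
  obtain N where N: "N \<ge> 0" "\<And>i. \<bar>i\<bar> > N \<Longrightarrow> w i = i" using S_Z_window[OF wZ] by metis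
  have "\<forall>i. i \<notin> {1..int (nat N)} \<longrightarrow> w i = i"
  proof (intro allI impI)
    fix i assume "i \<notin> {1..int (nat N)}"
    then have "i \<le> 0 \<or> \<bar>i\<bar> > N" using N(1) by auto
    then show "w i = i" using N(2) S_inf_fix[OF assms] by blast
  qed
  moreover have "\<forall>y. \<exists>!x. w x = y" using S_Z_bij[OF wZ] by (simp add: bij_iff)
  ultimately have "w \<in> S_fin (nat N)" unfolding S_fin_def permutes_def by blast
  then show ?thesis using that by blast
qed

lemma S_fin_mono: "w \<in> S_fin m \<Longrightarrow> m \<le> n \<Longrightarrow> w \<in> S_fin n"
  unfolding S_fin_def using permutes_subset[of w "{1..int m}" "{1..int n}"] by auto

lemma longest_longest [simp]: "longest n (longest n i) = i"
  by (auto simp: longest_def)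

lemma longest_comp_longest [simp]: "longest n \<circ> longest n = id"
  by (auto simp: fun_eq_iff)

lemma inv_longest [simp]: "inv (longest n) = longest n"
  by (rule inv_unique_comp) simp_all

lemma longest_S_fin: "longest n \<in> S_fin n"
  unfolding S_fin_def by (auto intro!: bij_imp_permutes bij_betwI[of _ _ _ "longest n"] simp: longest_def)

lemma longest_less_iff: "{i, j} \<subseteq> {1..int n} \<Longrightarrow> longest n i < longest n j \<longleftrightarrow> j < i"
  by (auto simp: longest_def)

lemma S_fin_comp: "v \<in> S_fin n \<Longrightarrow> w \<in> S_fin n \<Longrightarrow> v \<circ> w \<in> S_fin n"
  by (simp add: S_fin_def permutes_compose)

lemma S_fin_inv: "v \<in> S_fin n \<Longrightarrow> inv v \<in> S_fin n"
  by (simp add: S_fin_def permutes_inv)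

lemma S_fin_fix: "w \<in> S_fin n \<Longrightarrow> i > int n \<Longrightarrow> w i = i"
  unfolding S_fin_def by (auto intro: permutes_not_in)

lemma S_fin_range: "w \<in> S_fin n \<Longrightarrow> 1 \<le> i \<Longrightarrow> i \<le> int n \<Longrightarrow> 1 \<le> w i \<and> w i \<le> int n"
  unfolding S_fin_def using permutes_in_image[of w "{1..int n}" i] by simp

text \<open>The cycles \<open>s\<^sub>n \<circ> \<dots> \<circ> s\<^bsub>k+1\<^esub>\<close>.\<close>

definition descending_cycle :: "nat \<Rightarrow> int \<Rightarrow> int \<Rightarrow> int" where
  "descending_cycle n k i =
     (if i = k + 1 then int n + 1 else if k + 1 < i \<and> i \<le> int n + 1 then i - 1 else i)"

lemma descending_cycle_step:
  "k \<le> int n \<Longrightarrow> descending_cycle n (k - 1) = descending_cycle n k \<circ> simple k"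
  by (auto simp: fun_eq_iff descending_cycle_def simple_def transpose_def)

lemma descending_cycle_0: "descending_cycle n 0 = longest n \<circ> longest (Suc n)"
  by (auto simp: fun_eq_iff descending_cycle_def longest_def)

text \<open>Each further letter \<open>k\<close> moves the value \<open>n + 1\<close> from position \<open>k + 1\<close> to the left past a value of
  \<open>u\<close>, which is smaller; so every step creates an inversion.\<close>

lemma reduced_word_descending_cycle:
  assumes "u \<in> S_fin n" "reduced_word c u" "m \<le> n"
  shows "reduced_word (c @ rev [int n - int m + 1..int n]) (u \<circ> descending_cycle n (int n - int m))"
  using assms(3)
proof (induction m)
  case 0
  have "descending_cycle n (int n) = id" by (auto simp: fun_eq_iff descending_cycle_def)
  then show ?case using assms(2) by simp
next
  case (Suc m)
  define k where "k = int n - int m"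
  have k: "1 \<le> k" "k \<le> int n" "int n - int (Suc m) = k - 1" using Suc(2) by (auto simp: k_def)
  have r: "reduced_word (c @ rev [k + 1..int n]) (u \<circ> descending_cycle n k)"
    unfolding k_def by (rule Suc.IH[OF Suc_leD[OF Suc.prems]])
  have "(u \<circ> descending_cycle n k) k = u k" "(u \<circ> descending_cycle n k) (k + 1) = int n + 1"
    using S_fin_fix[OF assms(1), of "int n + 1"] by (auto simp: descending_cycle_def)
  then have "(u \<circ> descending_cycle n k) k < (u \<circ> descending_cycle n k) (k + 1)"
    using S_fin_range[OF assms(1), of k] k by linarith
  note step = reduced_word_append1[OF r k(1) this]
  have word: "c @ rev [k - 1 + 1..int n] = (c @ rev [k + 1..int n]) @ [k]"
    using upto_rec1[of k "int n"] k(2) by simp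
  show ?case
    unfolding k(3) descending_cycle_step[OF k(2)] comp_assoc[symmetric] word by (rule step)
qed

definition staircase :: "nat \<Rightarrow> zpoly" where
  "staircase n = (\<Prod>i\<in>{1..<n}. X (int i) ^ (n - i))"

text \<open>\<open>staircase (n + 1)\<close> with the exponents of the first \<open>k\<close> variables lowered by one.\<close>

definition partial_staircase :: "nat \<Rightarrow> nat \<Rightarrow> zpoly" where
  "partial_staircase n k = (\<Prod>i\<in>{1..<Suc n}. X (int i) ^ (if i \<le> k then n - i else Suc n - i))"

lemma partial_staircase_0: "partial_staircase n 0 = staircase (Suc n)"
  unfolding partial_staircase_def staircase_def by (rule prod.cong) auto

lemma partial_staircase_n: "partial_staircase n n = staircase n"
proof -
  have "partial_staircase n n = (\<Prod>i\<in>{1..<Suc n}. X (int i) ^ (n - i))"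
    unfolding partial_staircase_def by (rule prod.cong) auto
  also have "\<dots> = staircase n"
    unfolding staircase_def by (rule prod.mono_neutral_right) auto
  finally show ?thesis .
qed

text \<open>Since \<open>partial_staircase n (k + 1)\<close> has equal exponents at \<open>k + 1\<close> and \<open>k + 2\<close>, it is symmetric in
  these variables, and the one additional factor \<open>X (k + 1)\<close> has divided difference one.\<close>

lemma ddiff_partial_staircase:
  assumes "k < n"
  shows "ddiff (int (Suc k)) (partial_staircase n k) = partial_staircase n (Suc k)"
proof -
  let ?e = "\<lambda>k i. if i \<le> k then n - i else Suc n - i"
  let ?s = "simple (int (Suc k))" and ?t = "transpose (Suc k) (Suc (Suc k))"
  have fac: "partial_staircase n k = X (int (Suc k)) * partial_staircase n (Suc k)"
  proof -
    have "partial_staircase n k = (\<Prod>i\<in>{1..<Suc n}. (if i = Suc k then X (int (Suc k)) else 1) * X (int i) ^ ?e (Suc k) i)"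
      unfolding partial_staircase_def
    proof (rule prod.cong)
      fix i assume "i \<in> {1..<Suc n}"
      have "Suc n - Suc k = Suc (n - Suc k)" using assms by simp
      then show "X (int i) ^ ?e k i = (if i = Suc k then X (int (Suc k)) else 1) * X (int i) ^ ?e (Suc k) i"
        by (cases "i = Suc k") auto
    qed simp
    also have "\<dots> = X (int (Suc k)) * partial_staircase n (Suc k)"
      unfolding prod.distrib partial_staircase_def using assms by (simp add: prod.delta)
    finally show ?thesis .
  qed
  have ext: "partial_staircase n (Suc k) = (\<Prod>i\<in>{1..Suc n}. X (int i) ^ ?e (Suc k) i)"
    unfolding partial_staircase_def by (rule prod.mono_neutral_left) auto
  have "act ?s (partial_staircase n (Suc k)) = (\<Prod>i\<in>{1..Suc n}. X (?s (int i)) ^ ?e (Suc k) i)"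
    unfolding ext by (simp add: act_prod act_power)
  also have "\<dots> = (\<Prod>i\<in>{1..Suc n}. X (int i) ^ ?e (Suc k) i)"
  proof (rule prod.reindex_bij_witness[of _ ?t ?t])
    fix i assume i: "i \<in> {1..Suc n}"
    show "?t (?t i) = i" "?t (?t i) = i" by simp_all
    show "?t i \<in> {1..Suc n}" "?t i \<in> {1..Suc n}" using i assms by (auto simp: transpose_def)
    have 1: "int (?t i) = ?s (int i)" by (auto simp: transpose_def simple_def)
    have 2: "?e (Suc k) (?t i) = ?e (Suc k) i" using assms by (auto simp: transpose_def)
    show "X (int (?t i)) ^ ?e (Suc k) (?t i) = X (?s (int i)) ^ ?e (Suc k) i"
      unfolding 1 2 ..
  qed
  also have "\<dots> = partial_staircase n (Suc k)" by (simp only: ext)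
  finally have "ddiff (int (Suc k)) (partial_staircase n (Suc k)) = 0" by (simp add: ddiff_eq_0_iff)
  then show ?thesis unfolding fac by (simp add: ddiff_mult ddiff_X)
qed

lemma foldr_ddiff_staircase: "foldr ddiff (rev [1..int n]) (staircase (Suc n)) = staircase n"
proof -
  have "foldr ddiff (rev [1..int k]) (partial_staircase n 0) = partial_staircase n k" if "k \<le> n" for k
    using that
  proof (induction k)
    case (Suc k)
    have "[1..int (Suc k)] = [1..int k] @ [int (Suc k)]" using upto_rec2[of 1 "int (Suc k)"] by simp
    then show ?case using Suc ddiff_partial_staircase[of k n] by simp
  qed simp
  from this[of n] show ?thesis by (simp add: partial_staircase_0 partial_staircase_n)
qed

lemma schubert_n_alt: "schubert_n n v = ddiff_perm (inv v \<circ> longest n) (staircase n)"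
  by (simp add: schubert_n_def staircase_def)

text \<open>Passing from \<open>longest n\<close> to \<open>longest (n + 1)\<close> appends a descending cycle, whose divided differences
  turn the larger staircase monomial into the smaller one.\<close>

lemma schubert_n_Suc:
  assumes "v \<in> S_fin n"
  shows "schubert_n (Suc n) v = schubert_n n v"
proof -
  let ?u = "inv v \<circ> longest n"
  have u: "?u \<in> S_fin n" by (rule S_fin_comp[OF S_fin_inv[OF assms] longest_S_fin])
  obtain c where c: "reduced_word c ?u" using reduced_word_exists[OF S_fin_S_inf[OF u]] by blast
  have "?u \<circ> descending_cycle n 0 = inv v \<circ> longest (Suc n)"
    unfolding descending_cycle_0 by (simp add: fun_eq_iff)
  then have "reduced_word (c @ rev [1..int n]) (inv v \<circ> longest (Suc n))"
    using reduced_word_descending_cycle[OF u c, of n] by simp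
  then show ?thesis
    unfolding schubert_n_alt using ddiff_perm_eq[OF c]
    by (simp add: ddiff_perm_eq foldr_ddiff_staircase)
qed

lemma schubert_eq:
  assumes "v \<in> S_fin n"
  shows "schubert v = schubert_n n v"
proof -
  define m where "m = (LEAST n. v \<in> S_fin n)"
  have m: "v \<in> S_fin m" unfolding m_def using assms by (rule LeastI)
  have "m \<le> n" unfolding m_def using assms by (rule Least_le)
  then have "schubert_n n v = schubert_n m v"
  proof (induction n rule: dec_induct)
    case (step k)
    then show ?case using schubert_n_Suc[OF S_fin_mono[OF m]] by simp
  qed simp
  then show ?thesis by (simp add: schubert_def m_def)
qed

lemma inv_inv_longest:
  assumes "v \<in> S_fin n"
  shows "inv (inv v \<circ> longest n) = longest n \<circ> v"
proof -
  have "bij v" "bij (longest n)"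
    using S_Z_bij[OF S_inf_S_Z[OF S_fin_S_inf]] assms longest_S_fin by blast+
  then show ?thesis by (simp add: o_inv_distrib bij_imp_bij_inv inv_inv_eq)
qed

text \<open>With \<open>u = inv v \<circ> longest n\<close> one has \<open>inv u = longest n \<circ> v\<close>, so a descent of \<open>v\<close> at \<open>i\<close> means that
  one more divided difference may be applied to the left of those of \<open>u\<close>; at an ascent \<open>ddiff i\<close> is
  already the last one applied, and its square is zero. The window \<open>n\<close> is chosen so large that it
  contains \<open>i\<close> and \<open>i + 1\<close>.\<close>

lemma ddiff_schubert:
  assumes v: "v \<in> S_inf" and i: "1 \<le> i"
  shows "ddiff i (schubert v) = (if v i > v (i + 1) then schubert (v \<circ> simple i) else 0)"
proof -
  obtain n0 where "v \<in> S_fin n0" using S_inf_S_fin v by blast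
  then obtain n where n: "v \<in> S_fin n" "i + 1 \<le> int n"
    using S_fin_mono[of v n0 "max n0 (nat (i + 1))"] by fastforce
  let ?u = "inv v \<circ> longest n"
  have u: "?u \<in> S_inf"
    by (rule S_fin_S_inf[OF S_fin_comp[OF S_fin_inv[OF n(1)] longest_S_fin]])
  have iu: "inv ?u i < inv ?u (i + 1) \<longleftrightarrow> v (i + 1) < v i" "inv ?u (i + 1) < inv ?u i \<longleftrightarrow> v i < v (i + 1)"
    using S_fin_range[OF n(1), of i] S_fin_range[OF n(1), of "i + 1"] i n(2)
    by (auto simp: inv_inv_longest[OF n(1)] longest_less_iff)
  have s: "simple i \<in> S_fin n"
    unfolding S_fin_def simple_def using i n(2) by (auto intro: permutes_swap_id)
  have bv: "bij v" using v S_inf_S_Z S_Z_bij by blast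
  show ?thesis
  proof (cases "v i > v (i + 1)")
    case True
    have "inv (v \<circ> simple i) \<circ> longest n = simple i \<circ> ?u"
      using bv by (simp add: o_inv_distrib comp_assoc)
    then have "schubert (v \<circ> simple i) = ddiff_perm (simple i \<circ> ?u) (staircase n)"
      using schubert_eq[OF S_fin_comp[OF n(1) s]] by (simp add: schubert_n_alt)
    then show ?thesis
      using True iu ddiff_perm_simple_comp[OF u i] schubert_eq[OF n(1)] by (simp add: schubert_n_alt)
  next
    case False
    then have "v i < v (i + 1)" using S_Z_neq[OF S_inf_S_Z[OF v], of i "i + 1"] by simp
    then show ?thesis
      using False iu ddiff_ddiff_perm_eq_0[OF u i] schubert_eq[OF n(1)] by (simp add: schubert_n_alt)
  qed
qed

lemma homogeneous_staircase: "homogeneous (\<Sum>i\<in>{1..<n}. n - i) (staircase n)"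
proof -
  have pow: "homogeneous (k + d) (X (int i) ^ k * f)" if "homogeneous d f" "1 \<le> i" for i k d f
    using that by (induction k) (auto simp: mult.assoc intro: homogeneous.intros)
  have "homogeneous (\<Sum>i\<in>I. n - i) (\<Prod>i\<in>I. X (int i) ^ (n - i))" if "finite I" "I \<subseteq> {1..}" for I
    using that
  proof (induction I rule: finite_induct)
    case empty
    show ?case using homogeneous.const[of 1] by simp
  next
    case (insert i I)
    then show ?case using pow[of "\<Sum>i\<in>I. n - i" "\<Prod>i\<in>I. X (int i) ^ (n - i)" i "n - i"] by simp
  qed
  from this[of "{1..<n}"] show ?thesis by (simp add: staircase_def subset_iff)
qed

lemma homogeneous_foldr_ddiff:
  "homogeneous d f \<Longrightarrow> \<forall>i\<in>set a. 1 \<le> i \<Longrightarrow> homogeneous (d - length a) (foldr ddiff a f)"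
proof (induction a)
  case (Cons i a)
  then have "homogeneous (d - length a - 1) (ddiff i (foldr ddiff a f))"
    by (intro homogeneous_ddiff) auto
  then show ?case by simp
qed simp

lemma len_S_fin_le:
  assumes "w \<in> S_fin n"
  shows "len w \<le> (\<Sum>i\<in>{1..<n}. n - i)"
proof -
  let ?P = "SIGMA i:{1..<n}. {i<..n}"
  have "invs w \<subseteq> (\<lambda>(i, j). (int i, int j)) ` ?P"
  proof
    fix x assume "x \<in> invs w"
    then obtain i j where x: "x = (i, j)" "i < j" "w i > w j" by (auto simp: invs_def)
    have wi: "w i = i" if "i \<le> 0" for i using S_inf_fix S_fin_S_inf assms that by blast
    have "1 \<le> i"
    proof (rule ccontr)
      assume "\<not> 1 \<le> i"
      then show False
        using x wi[of i] wi[of j] S_inf_pos[OF S_fin_S_inf[OF assms], of j] by (cases "j \<le> 0") auto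
    qed
    moreover have "j \<le> int n"
    proof (rule ccontr)
      assume "\<not> j \<le> int n"
      then show False
        using x S_fin_fix[OF assms, of j] S_fin_fix[OF assms, of i] S_fin_range[OF assms, of i] \<open>1 \<le> i\<close>
        by (cases "i \<le> int n") auto
    qed
    ultimately have "(nat i, nat j) \<in> ?P" "x = (\<lambda>(i, j). (int i, int j)) (nat i, nat j)"
      using x by auto
    then show "x \<in> (\<lambda>(i, j). (int i, int j)) ` ?P" by blast
  qed
  then have "len w \<le> card ((\<lambda>(i, j). (int i, int j)) ` ?P)"
    unfolding len_invs by (intro card_mono) auto
  also have "\<dots> \<le> card ?P" by (rule card_image_le) auto
  also have "\<dots> = (\<Sum>i\<in>{1..<n}. n - i)" by (simp add: card_SigmaI)
  finally show ?thesis .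
qed

lemma schubert_homogeneous:
  assumes "v \<in> S_fin n"
  shows "homogeneous ((\<Sum>i\<in>{1..<n}. n - i) - len (inv v \<circ> longest n)) (schubert v)"
proof -
  let ?u = "inv v \<circ> longest n"
  have "?u \<in> S_inf" 
    by (rule S_fin_S_inf[OF S_fin_comp[OF S_fin_inv[OF assms] longest_S_fin]])
  then obtain c where c: "reduced_word c ?u" using reduced_word_exists by blast
  then show ?thesis
    using homogeneous_foldr_ddiff[OF homogeneous_staircase, of c n] schubert_eq[OF assms] ddiff_perm_eq[OF c]
    by (simp add: schubert_n_alt reduced_word_alt)
qed

lemma schubert_in_vars: "v \<in> S_inf \<Longrightarrow> in_vars {1..} (schubert v)"
  using S_inf_S_fin schubert_homogeneous homogeneous_vars by metis

text \<open>A descent of \<open>v\<close> shows that \<open>inv v \<circ> longest n\<close> is not of maximal length, so fewer divided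
  differences are taken than the degree of the staircase monomial.\<close>

lemma schubert_vanishing:
  assumes "v \<in> S_inf" "v \<noteq> id"
  shows "vanishing (schubert v)"
proof -
  obtain i where d: "v i > v (i + 1)" using descent_exists[OF S_inf_S_Z[OF assms(1)] assms(2)] by blast
  have i: "1 \<le> i" using S_inf_descent assms(1) d by blast
  obtain n where n: "v \<in> S_fin n" using S_inf_S_fin assms(1) by blast
  have in': "i + 1 \<le> int n"
  proof (rule ccontr)
    assume "\<not> i + 1 \<le> int n"
    then show False
      using d S_fin_fix[OF n, of i] S_fin_fix[OF n, of "i + 1"] S_fin_range[OF n, of i] i
      by (cases "i \<le> int n") auto
  qed
  let ?u = "inv v \<circ> longest n"
  have u: "?u \<in> S_fin n" by (rule S_fin_comp[OF S_fin_inv[OF n] longest_S_fin])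
  have "inv ?u i < inv ?u (i + 1)"
    using d S_fin_range[OF n, of i] S_fin_range[OF n, of "i + 1"] i in'
    by (auto simp: inv_inv_longest[OF n] longest_less_iff)
  then have "len (simple i \<circ> ?u) = Suc (len ?u)"
    by (rule len_simple_comp[OF S_inf_S_Z[OF S_fin_S_inf[OF u]]])
  moreover have "simple i \<in> S_fin n"
    unfolding S_fin_def simple_def using i in' by (auto intro: permutes_swap_id)
  ultimately have "len ?u < (\<Sum>i\<in>{1..<n}. n - i)"
    using len_S_fin_le[OF S_fin_comp[OF _ u], of "simple i"] by simp
  then show ?thesis using homogeneous_vanishing[OF schubert_homogeneous[OF n]] by simp
qed

section \<open>Conjugation of fixed-point-free involutions\<close>

lemma Theta_Theta [simp]: "Theta (Theta i) = i"
  by (simp add: Theta_def)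

lemma Theta_neq [simp]: "Theta i \<noteq> i"
  by (simp add: Theta_def)

lemma F_Z_I: "w \<in> S_Z \<Longrightarrow> inv w \<circ> Theta \<circ> w \<in> F_Z"
  unfolding F_Z_def by blast

lemma F_Z_invol [simp]: "y \<in> F_Z \<Longrightarrow> y (y i) = i"
proof -
  assume "y \<in> F_Z"
  then obtain w where w: "w \<in> S_Z" "y = inv w \<circ> Theta \<circ> w" unfolding F_Z_def by blast
  have "w (inv w k) = k" "inv w (w k) = k" for k
    using S_Z_bij[OF w(1)] by (auto simp: surj_f_inv_f bij_is_surj bij_is_inj)
  then show ?thesis by (simp add: w(2))
qed

lemma F_Z_neq [simp]: "y \<in> F_Z \<Longrightarrow> y i \<noteq> i"
proof
  assume "y \<in> F_Z" "y i = i"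
  then obtain w where w: "w \<in> S_Z" "y = inv w \<circ> Theta \<circ> w" unfolding F_Z_def by blast
  have "w (inv w k) = k" for k
    using S_Z_bij[OF w(1)] by (auto simp: surj_f_inv_f bij_is_surj)
  from this[of "Theta (w i)"] \<open>y i = i\<close> have "w i = Theta (w i)" by (simp add: w(2))
  then show False using Theta_neq[of "w i"] by simp
qed

lemma F_Z_window:
  assumes "y \<in> F_Z"
  obtains N where "N \<ge> 0" "\<And>i. \<bar>i\<bar> > N + 1 \<Longrightarrow> y i = Theta i"
proof -
  obtain w where w: "w \<in> S_Z" "y = inv w \<circ> Theta \<circ> w" using assms unfolding F_Z_def by blast
  obtain N where N: "N \<ge> 0" "\<And>i. \<bar>i\<bar> > N \<Longrightarrow> w i = i" using S_Z_window[OF w(1)] by metis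
  have bw: "bij w" by (rule S_Z_bij[OF w(1)])
  have far: "y i = Theta i" if "\<bar>i\<bar> > N + 1" for i
  proof -
    have "\<bar>Theta i\<bar> > N" using that by (auto simp: Theta_def)
    then have "inv w (Theta i) = Theta i" using N(2) bw by (metis inv_f_f bij_is_inj)
    moreover have "w i = i" using N(2) that by simp
    ultimately show ?thesis by (simp add: w(2))
  qed
  with N(1) that show ?thesis by blast
qed

lemma F_Z_eq_iff: "y \<in> F_Z \<Longrightarrow> y i = j \<longleftrightarrow> i = y j"
  using F_Z_invol by metis

lemma F_Z_inj: "y \<in> F_Z \<Longrightarrow> y i = y j \<longleftrightarrow> i = j"
  using F_Z_invol by metis

lemma conj_transp_apply: "conj_transp i j y k = transpose i j (y (transpose i j k))"
  by (simp add: conj_transp_def)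

lemma conj_transp_simple_apply: "conj_transp a (a + 1) y k = simple a (y (simple a k))"
  by (simp add: conj_transp_def simple_def)

lemma transpose_S_Z: "transpose i j \<in> S_Z" for i j :: int
proof -
  have "{k. transpose i j k \<noteq> k} \<subseteq> {i, j}" by (auto simp: transpose_def)
  then show ?thesis unfolding S_Z_def using finite_subset by auto
qed

lemma conj_atom: "bij w \<Longrightarrow> inv (w \<circ> transpose i j) \<circ> Theta \<circ> (w \<circ> transpose i j)
    = conj_transp i j (inv w \<circ> Theta \<circ> w)"
  by (simp add: o_inv_distrib conj_transp_def comp_assoc)

lemma conj_F_Z: "y \<in> F_Z \<Longrightarrow> conj_transp i j y \<in> F_Z"
proof -
  assume "y \<in> F_Z"
  then obtain w where w: "w \<in> S_Z" "y = inv w \<circ> Theta \<circ> w" unfolding F_Z_def by blast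
  have "w \<circ> transpose i j \<in> S_Z" using w(1) transpose_S_Z by (rule S_Z_comp)
  from F_Z_I[OF this] show ?thesis unfolding conj_atom[OF S_Z_bij[OF w(1)]] w(2) .
qed

lemma conj_conj [simp]: "conj_transp i j (conj_transp i j y) = y"
  by (simp add: fun_eq_iff conj_transp_apply)

lemma conj_transp_commute: "conj_transp i j y = conj_transp j i y"
  by (simp add: conj_transp_def transpose_commute)

lemma conj_partner_fix: "y \<in> F_Z \<Longrightarrow> y i = j \<Longrightarrow> conj_transp i j y = y"
proof
  fix k assume y: "y \<in> F_Z" "y i = j"
  then have yj: "y j = i" by auto
  have ij: "i \<noteq> j" using y F_Z_neq by blast
  consider "k = i" | "k = j" | "k \<noteq> i" "k \<noteq> j" by blast
  then show "conj_transp i j y k = y k"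
  proof cases
    case 3
    then have "y k \<noteq> j" "y k \<noteq> i" using F_Z_inj[OF y(1), of k] y(2) yj by metis+
    then show ?thesis using 3 by (simp add: conj_transp_apply)
  qed (simp_all add: conj_transp_apply y(2) yj)
qed

text \<open>Conjugation by \<open>(i, j)\<close> exchanges the partners of two cycles, which may be described from
  either side.\<close>

lemma conj_partner:
  assumes y: "y \<in> F_Z"
  shows "conj_transp (y i) (y j) y = conj_transp i j y"
proof (cases "y i = j")
  case True
  then have "y j = i" using y by auto
  then show ?thesis using True conj_partner_fix[OF y True] by (simp add: conj_transp_commute)
next
  case False
  then have ne: "y i \<noteq> j" "y j \<noteq> i" "y i \<noteq> i" "y j \<noteq> j" using y F_Z_invol[OF y, of j] by auto
  show ?thesis
  proof
    fix k
    consider "k = i" | "k = j" | "k = y i" | "k = y j" | "k \<notin> {i, j, y i, y j}" by blast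
    then show "conj_transp (y i) (y j) y k = conj_transp i j y k"
    proof cases
      case 5
      then have "y k \<notin> {i, j, y i, y j}" using F_Z_invol[OF y] by (metis insert_iff singletonD)
      then show ?thesis using 5 by (simp add: conj_transp_apply)
    qed (use ne y in \<open>simp_all add: conj_transp_apply not_sym[OF ne(1)] not_sym[OF ne(2)]
        not_sym[OF ne(3)] not_sym[OF ne(4)]\<close>)
  qed
qed

lemma conj_conj_simple:
  "conj_transp (simple a i) (simple a j) (conj_transp a (a + 1) y) = conj_transp a (a + 1) (conj_transp i j y)"
proof -
  have t: "transpose (simple a i) (simple a j) (simple a k) = simple a (transpose i j k)" for k
    using simple_simps(4)[of a] by (metis transpose_apply_first transpose_apply_other transpose_apply_second)
  have t': "transpose (simple a i) (simple a j) k = simple a (transpose i j (simple a k))" for k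
    using t[of "simple a k"] by simp
  show ?thesis
    by (rule ext, unfold conj_transp_apply[of "simple a i" "simple a j"] t' conj_transp_simple_apply
        conj_transp_apply[of i j] simple_simps(4)) (rule refl)
qed

section \<open>The length of a fixed-point-free involution\<close>

text \<open>\<open>Inv y\<close> is infinite, as every cycle of \<open>y\<close> is an inversion; without the cycles a finite set is
  left.\<close>

definition proper_inv :: "(int \<Rightarrow> int) \<Rightarrow> (int \<times> int) set" where
  "proper_inv y = Inv y - Cyc_Z y"

lemma proper_inv_iff: "(i, j) \<in> proper_inv y \<longleftrightarrow> i < j \<and> y i > y j \<and> y i \<noteq> j"
  by (auto simp: proper_inv_def Inv_def Cyc_Z_def)

lemma proper_inv_Theta: "proper_inv Theta = {}"
proof -
  have "(i, j) \<notin> proper_inv Theta" for i j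
  proof
    assume "(i, j) \<in> proper_inv Theta"
    then have "i < j" "Theta i > Theta j" "Theta i \<noteq> j" by (auto simp: proper_inv_iff)
    then show False by (auto simp: Theta_def split: if_splits)
  qed
  then show ?thesis by auto
qed

text \<open>Renaming positions and values by \<open>simple a\<close> preserves inversions, with two exceptions: the
  positions \<open>a\<close> and \<open>a + 1\<close>, and the positions of the values \<open>a\<close> and \<open>a + 1\<close>. Both exceptional pairs
  become inversions.\<close>

lemma proper_inv_simple:
  assumes y: "y \<in> F_Z" and a: "y a < y (a + 1)"
  shows "proper_inv (conj_transp a (a + 1) y)
    = insert (a, a + 1) (insert (y a, y (a + 1)) (map_prod (simple a) (simple a) ` proper_inv y))"
proof (intro set_eqI)
  let ?s = "simple a" let ?z = "conj_transp a (a + 1) y"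
  fix x :: "int \<times> int" obtain i j where x: "x = (i, j)" by (cases x)
  have ya: "y a \<noteq> a" "y a \<noteq> a + 1" "y (a + 1) \<noteq> a" "y (a + 1) \<noteq> a + 1"
    using a F_Z_neq[OF y] F_Z_invol[OF y, of a] F_Z_invol[OF y, of "a + 1"] by force+
  have im: "x \<in> map_prod ?s ?s ` proper_inv y \<longleftrightarrow> (?s i, ?s j) \<in> proper_inv y"
  proof
    assume "(?s i, ?s j) \<in> proper_inv y"
    then have "map_prod ?s ?s (?s i, ?s j) \<in> map_prod ?s ?s ` proper_inv y" by (rule imageI)
    then show "x \<in> map_prod ?s ?s ` proper_inv y" by (simp add: x)
  qed (auto simp: x)
  have z: "x \<in> proper_inv ?z \<longleftrightarrow> i < j \<and> ?s (y (?s i)) > ?s (y (?s j)) \<and> ?s (y (?s i)) \<noteq> j"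
    by (simp add: x proper_inv_iff conj_transp_simple_apply)
  consider "(i, j) = (a, a + 1)" | "(i, j) = (a + 1, a)" | "{i, j} \<noteq> {a, a + 1}" "{y (?s i), y (?s j)} = {a, a + 1}"
    | "{i, j} \<noteq> {a, a + 1}" "{y (?s i), y (?s j)} \<noteq> {a, a + 1}" by (auto simp: doubleton_eq_iff)
  then show "x \<in> proper_inv ?z \<longleftrightarrow> x \<in> insert (a, a + 1) (insert (y a, y (a + 1)) (map_prod ?s ?s ` proper_inv y))"
  proof cases
    case 1
    have "?s (y a) = y a" "?s (y (a + 1)) = y (a + 1)" using ya by (auto intro: simple_other)
    with 1 show ?thesis unfolding z using a ya by (auto simp: x)
  next
    case 2
    then show ?thesis unfolding z insert_iff im using a ya by (auto simp: x proper_inv_iff)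
  next
    case 3
    have fix1: "?s (y a) = y a" "?s (y (a + 1)) = y (a + 1)" using ya by (auto intro: simple_other)
    from 3(2) consider "y (?s i) = a" "y (?s j) = a + 1" | "y (?s i) = a + 1" "y (?s j) = a"
      by (auto simp: doubleton_eq_iff)
    then show ?thesis
    proof cases
      case 1
      then have "?s i = y a" "?s j = y (a + 1)" using F_Z_eq_iff[OF y] by metis+
      then have "i = y a" "j = y (a + 1)" using fix1 simple_simps(4)[of a] by metis+
      then show ?thesis unfolding z using a ya 1 by (simp add: x)
    next
      case 2
      then have s: "?s i = y (a + 1)" "?s j = y a" using F_Z_eq_iff[OF y] by metis+
      then have "i = y (a + 1)" "j = y a" using fix1 simple_simps(4)[of a] by metis+
      then show ?thesis unfolding z insert_iff im using a ya s by (auto simp: x proper_inv_iff)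
    qed
  next
    case 4
    have n1: "x \<noteq> (a, a + 1)" using 4(1) by (auto simp: x)
    have n2: "x \<noteq> (y a, y (a + 1))"
    proof
      assume "x = (y a, y (a + 1))"
      then have "(i, j) = (y a, y (a + 1))" by (simp only: x)
      then have "?s i = y a" "?s j = y (a + 1)" using ya by (auto intro: simple_other)
      then show False using 4(2) y by simp
    qed
    have e1: "i < j \<longleftrightarrow> ?s i < ?s j" using simple_less_iff[OF 4(1)] by simp
    have e2: "?s (y (?s j)) < ?s (y (?s i)) \<longleftrightarrow> y (?s j) < y (?s i)"
      using simple_less_iff[of "y (?s j)" "y (?s i)" a] 4(2) by (simp add: insert_commute)
    have e3: "?s (y (?s i)) = j \<longleftrightarrow> y (?s i) = ?s j" using simple_simps(4)[of a] by metis
    show ?thesis using n1 n2 unfolding z insert_iff im proper_inv_iff e1 e2 e3 by blast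
  qed
qed

lemma inj_map_prod_simple: "inj_on (map_prod (simple a) (simple a)) A"
  by (rule inj_onI) (metis map_prod_simp prod.collapse prod.inject simple_simps(4))

lemma card_proper_inv_simple:
  assumes y: "y \<in> F_Z" and a: "y a < y (a + 1)" and fin: "finite (proper_inv y)"
  shows "card (proper_inv (conj_transp a (a + 1) y)) = card (proper_inv y) + 2"
proof -
  let ?s = "simple a" let ?I = "map_prod ?s ?s ` proper_inv y"
  have ya: "y a \<noteq> a" "y a \<noteq> a + 1" "y (a + 1) \<noteq> a" "y (a + 1) \<noteq> a + 1"
    using a F_Z_neq[OF y] F_Z_invol[OF y, of a] F_Z_invol[OF y, of "a + 1"] by force+
  have mem: "(?s i, ?s j) \<in> proper_inv y" if "(i, j) \<in> ?I" for i j
    using that by auto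
  have "(a, a + 1) \<notin> ?I"
  proof
    assume "(a, a + 1) \<in> ?I"
    then have "(?s a, ?s (a + 1)) \<in> proper_inv y" by (rule mem)
    then show False by (simp add: proper_inv_iff)
  qed
  moreover have "(y a, y (a + 1)) \<notin> ?I"
  proof
    assume "(y a, y (a + 1)) \<in> ?I"
    then have "(?s (y a), ?s (y (a + 1))) \<in> proper_inv y" by (rule mem)
    moreover have "?s (y a) = y a" "?s (y (a + 1)) = y (a + 1)" using ya by (auto intro: simple_other)
    ultimately show False using y by (simp add: proper_inv_iff)
  qed
  moreover have "card ?I = card (proper_inv y)" by (rule card_image[OF inj_map_prod_simple])
  ultimately show ?thesis using ya fin by (simp add: proper_inv_simple[OF y a])
qed

text \<open>Conjugation by \<open>simple a\<close> lowers the length exactly in this case. If \<open>a\<close> and \<open>a + 1\<close> form a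
  cycle, the pair is an inversion as well, but the conjugation has no effect.\<close>

definition descent :: "(int \<Rightarrow> int) \<Rightarrow> int \<Rightarrow> bool" where
  "descent z a \<longleftrightarrow> z (a + 1) < z a \<and> z a \<noteq> a + 1"

lemma F_Z_cases:
  assumes "y \<in> F_Z"
  obtains "y a < y (a + 1)" | "descent y a" | "y a = a + 1"
  using F_Z_inj[OF assms, of a "a + 1"] unfolding descent_def by force

lemma descent_conj:
  assumes y: "y \<in> F_Z" and a: "y a < y (a + 1)"
  shows "descent (conj_transp a (a + 1) y) a"
proof -
  have ya: "y a \<noteq> a" "y a \<noteq> a + 1" "y (a + 1) \<noteq> a" "y (a + 1) \<noteq> a + 1"
    using a F_Z_neq[OF y] F_Z_invol[OF y, of a] F_Z_invol[OF y, of "a + 1"] by force+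
  then have "simple a (y a) = y a" "simple a (y (a + 1)) = y (a + 1)" by (auto intro: simple_other)
  then show ?thesis using a ya by (simp add: descent_def conj_transp_simple_apply)
qed

lemma ascent_conj:
  assumes y: "y \<in> F_Z" and a: "descent y a"
  shows "conj_transp a (a + 1) y a < conj_transp a (a + 1) y (a + 1)"
proof -
  have ya: "y a \<noteq> a" "y a \<noteq> a + 1" "y (a + 1) \<noteq> a" "y (a + 1) \<noteq> a + 1"
    using a F_Z_neq[OF y] F_Z_invol[OF y, of a] F_Z_invol[OF y, of "a + 1"] unfolding descent_def by force+
  then have "simple a (y a) = y a" "simple a (y (a + 1)) = y (a + 1)" by (auto intro: simple_other)
  then show ?thesis using a by (simp add: descent_def conj_transp_simple_apply)
qed

lemma finite_even_proper_inv:
  assumes "y \<in> F_Z"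
  shows "finite (proper_inv y) \<and> even (card (proper_inv y))"
proof -
  obtain w where w: "w \<in> S_Z" "y = inv w \<circ> Theta \<circ> w" using assms unfolding F_Z_def by blast
  show ?thesis unfolding w(2) using w(1)
  proof (induction w rule: S_Z_induct)
    case id
    show ?case by (simp add: proper_inv_Theta)
  next
    case (ascent w a)
    define y where "y = inv w \<circ> Theta \<circ> w"
    let ?z = "conj_transp a (a + 1) y"
    have y: "y \<in> F_Z" unfolding y_def by (rule F_Z_I[OF ascent(1)])
    note IH = conjunct1[OF ascent(3)[folded y_def]] conjunct2[OF ascent(3)[folded y_def]]
    have "finite (proper_inv ?z) \<and> even (card (proper_inv ?z))"
    proof (cases rule: F_Z_cases[OF y, of a])
      case 1
      then show ?thesis using IH card_proper_inv_simple[OF y 1] by (simp add: proper_inv_simple[OF y 1])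
    next
      case 2
      note az = ascent_conj[OF y 2]
      have z: "?z \<in> F_Z" by (rule conj_F_Z[OF y])
      have "map_prod (simple a) (simple a) ` proper_inv ?z \<subseteq> proper_inv y"
        unfolding proper_inv_simple[OF z az, unfolded conj_conj] by blast
      from finite_imageD[OF finite_subset[OF this IH(1)] inj_map_prod_simple]
      have fin: "finite (proper_inv ?z)" .
      show ?thesis using IH(2) card_proper_inv_simple[OF z az fin, unfolded conj_conj] fin by simp
    next
      case 3
      then show ?thesis using IH conj_partner_fix[OF y 3] by simp
    qed
    moreover have "inv (w \<circ> simple a) \<circ> Theta \<circ> (w \<circ> simple a) = ?z"
      unfolding simple_def y_def by (rule conj_atom[OF S_Z_bij[OF ascent(1)]])
    ultimately show ?case by (simp only:)
  qed
qed

definition flen :: "(int \<Rightarrow> int) \<Rightarrow> nat" where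
  "flen y = card (proper_inv y) div 2"

lemma fpf_len_flen: "y \<in> F_Z \<Longrightarrow> fpf_len y = of_nat (flen y)"
proof -
  assume "y \<in> F_Z"
  then obtain k where "card (proper_inv y) = 2 * k" using finite_even_proper_inv by blast
  then show ?thesis by (simp add: fpf_len_def flen_def proper_inv_def[symmetric])
qed

lemma flen_Theta [simp]: "flen Theta = 0"
  by (simp add: flen_def proper_inv_Theta)

lemma flen_ascent:
  assumes "y \<in> F_Z" "y a < y (a + 1)"
  shows "flen (conj_transp a (a + 1) y) = Suc (flen y)"
  using card_proper_inv_simple[OF assms] finite_even_proper_inv[OF assms(1)] by (simp add: flen_def)

lemma flen_descent:
  assumes "y \<in> F_Z" "descent y a"
  shows "flen y = Suc (flen (conj_transp a (a + 1) y))"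
  using flen_ascent[OF conj_F_Z[OF assms(1)] ascent_conj[OF assms]] by simp

lemma flen_le: "y \<in> F_Z \<Longrightarrow> flen y \<le> Suc (flen (conj_transp a (a + 1) y))"
  by (rule F_Z_cases[of y a]) (auto simp: flen_ascent flen_descent conj_partner_fix)

lemma finite_descents: "y \<in> F_Z \<Longrightarrow> finite {a. descent y a}"
proof -
  assume y: "y \<in> F_Z"
  have "(\<lambda>a. (a, a + 1)) ` {a. descent y a} \<subseteq> proper_inv y"
    by (auto simp: proper_inv_iff descent_def)
  then have "finite ((\<lambda>a. (a, a + 1)) ` {a. descent y a})"
    using finite_even_proper_inv[OF y] finite_subset by blast
  then show ?thesis by (rule finite_imageD) (auto intro: inj_onI)
qed

section \<open>Conjugation by arbitrary transpositions\<close>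

text \<open>Induction on \<open>j - i\<close>, reducing \<open>(i, j)\<close> to \<open>(i + 1, j)\<close> by conjugation with \<open>simple i\<close>. If \<open>i\<close>
  and \<open>i + 1\<close> form a cycle, the conjugation has no effect on \<open>y\<close>; then, for \<open>y j < j\<close>, the pair
  \<open>(i, j)\<close> is replaced by the closer pair \<open>(i + 1, y j)\<close> of partners, which gives the same conjugate.\<close>

lemma flen_conj_less:
  assumes "y \<in> F_Z" "i < j" "y i < y j"
  shows "flen y < flen (conj_transp i j y)"
  using assms
proof (induction "nat (j - i)" arbitrary: i j y rule: less_induct)
  case less
  note y = less(2) and ij = less(3) and yij = less(4)
  let ?s = "simple i" and ?t = "transpose i j"
  define z where "z = conj_transp i j y"
  define y' where "y' = conj_transp i (i + 1) y"
  define z' where "z' = conj_transp (i + 1) j y'"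
  have Z: "z \<in> F_Z" "y' \<in> F_Z" "z' \<in> F_Z" unfolding z_def y'_def z'_def using y by (simp_all add: conj_F_Z)
  show ?case
  proof (cases "j = i + 1")
    case True
    then show ?thesis using flen_ascent[OF y] yij by simp
  next
    case False
    then have j: "i + 1 < j" using ij by simp
    have sj: "?s j = j" using j by (intro simple_other) auto
    have zz': "z = conj_transp i (i + 1) z'"
      using conj_conj_simple[of i "i + 1" j y'] unfolding z'_def[symmetric] simple_simps(2) sj
      unfolding y'_def conj_conj z_def .
    then have z'z: "z' = conj_transp i (i + 1) z" by simp
    have yj: "y j \<noteq> i" "y j \<noteq> j" using yij ij y by (auto simp: F_Z_eq_iff)
    have zi: "z i = y j" unfolding z_def conj_transp_apply using yj by simp
    have zi1: "z (i + 1) = ?t (y (i + 1))" unfolding z_def conj_transp_apply using j by simp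
    have IH: "flen y' < flen z'"
    proof -
      have "y' (i + 1) < y' j"
        unfolding y'_def conj_transp_simple_apply sj
        using simple_strict_mono[OF yij, of i] F_Z_neq[OF y, of i] by simp
      then show ?thesis unfolding z'_def using less(1)[of j "i + 1" y'] Z(2) j by simp
    qed
    show ?thesis
    proof (cases "y i = i + 1")
      case True
      then have yi1: "y (i + 1) = i" using y by (auto simp: F_Z_eq_iff)
      show ?thesis
      proof (cases "y j < j")
        case True
        have "flen y < flen (conj_transp (i + 1) (y j) y)"
          by (rule less(1)) (use True yij yi1 y ij \<open>y i = i + 1\<close> in auto)
        then show ?thesis using conj_partner[OF y, of i j] \<open>y i = i + 1\<close> by simp
      next
        case False
        have "y' = y" unfolding y'_def by (rule conj_partner_fix[OF y True])
        moreover have "descent z i"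
          unfolding descent_def zi zi1 yi1 using False yj j by simp
        then have "flen z = Suc (flen z')" unfolding z'z by (rule flen_descent[OF Z(1)])
        ultimately show ?thesis using IH unfolding z_def by simp
      qed
    next
      case False
      show ?thesis
      proof (cases "y (i + 1) < y i")
        case True
        then have "descent y i" using False by (simp add: descent_def)
        then have 1: "flen y = Suc (flen y')" unfolding y'_def by (rule flen_descent[OF y])
        have ne: "y (i + 1) \<noteq> i" using False y by (auto simp: F_Z_eq_iff)
        have ne2: "y (i + 1) \<noteq> j"
        proof
          assume "y (i + 1) = j"
          moreover from this have "y j = i + 1" using F_Z_invol[OF y, of "i + 1"] by simp
          ultimately show False using True yij j by simp
        qed
        then have "y j \<noteq> i + 1" using F_Z_invol[OF y, of j] by auto
        then have "descent z i"
          unfolding descent_def zi zi1 using ne ne2 True yij by simp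
        then have "flen z = Suc (flen z')" unfolding z'z by (rule flen_descent[OF Z(1)])
        then show ?thesis using 1 IH unfolding z_def by simp
      next
        case False
        then have "y i < y (i + 1)" using F_Z_inj[OF y, of i "i + 1"] by simp
        then have "flen y' = Suc (flen y)" unfolding y'_def by (rule flen_ascent[OF y])
        moreover have "flen z' \<le> Suc (flen z)" using flen_le[OF Z(3), of i] zz' by simp
        ultimately show ?thesis using IH unfolding z_def by simp
      qed
    qed
  qed
qed

lemma flen_conj_less_iff:
  assumes y: "y \<in> F_Z" and ij: "i < j"
  shows "flen y < flen (conj_transp i j y) \<longleftrightarrow> y i < y j"
proof
  assume less: "flen y < flen (conj_transp i j y)"
  show "y i < y j"
  proof (rule ccontr)
    assume "\<not> y i < y j"
    then have gt: "y j < y i" using F_Z_inj[OF y, of i j] ij by simp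
    have ne: "y i \<noteq> j" using less conj_partner_fix[OF y] by auto
    then have "y j \<noteq> i" using F_Z_invol[OF y, of j] by auto
    then have "conj_transp i j y i < conj_transp i j y j"
      using gt ne F_Z_neq[OF y] by (simp add: conj_transp_apply)
    from flen_conj_less[OF conj_F_Z[OF y] ij this] less show False by simp
  qed
qed (rule flen_conj_less[OF y ij])

text \<open>Conjugating both sides of an order relation by \<open>simple a\<close> preserves it, apart from the one
  relation that \<open>simple a\<close> itself creates.\<close>

lemma flen_conj_lift:
  assumes v: "v \<in> F_Z" and less: "flen v < flen (conj_transp i j v)"
    and ne: "conj_transp i j v \<noteq> conj_transp a (a + 1) v"
  shows "flen (conj_transp a (a + 1) v) < flen (conj_transp a (a + 1) (conj_transp i j v))"
proof -
  have main: "flen (conj_transp a (a + 1) v) < flen (conj_transp a (a + 1) (conj_transp i j v))"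
    if "i < j" and less: "flen v < flen (conj_transp i j v)"
      and ne: "conj_transp i j v \<noteq> conj_transp a (a + 1) v" for i j
  proof -
    have vij: "v i < v j" using flen_conj_less_iff[OF v \<open>i < j\<close>] less by simp
    have "(i, j) \<noteq> (a, a + 1)" using ne by auto
    then have 1: "simple a i < simple a j" by (rule simple_strict_mono[OF \<open>i < j\<close>])
    have "(v i, v j) \<noteq> (a, a + 1)" using ne conj_partner[OF v, of i j] by auto
    then have "simple a (v i) < simple a (v j)" by (rule simple_strict_mono[OF vij])
    then have 2: "conj_transp a (a + 1) v (simple a i) < conj_transp a (a + 1) v (simple a j)"
      by (simp add: conj_transp_simple_apply)
    from flen_conj_less[OF conj_F_Z[OF v] 1 2] show ?thesis by (simp only: conj_conj_simple)
  qed
  have "i \<noteq> j" using less by (auto simp: conj_transp_def)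
  then consider "i < j" | "j < i" by linarith
  then show ?thesis
  proof cases
    case 1
    then show ?thesis using main less ne by blast
  next
    case 2
    then show ?thesis using main[of j i] less ne conj_transp_commute[of i j v] by simp
  qed
qed

text \<open>The factorisation \<open>(i, j) = (i, e) (e, j) (i, e)\<close> passes from \<open>y\<close> to its conjugate in three steps,
  each of which raises the length.\<close>

lemma flen_conj_between:
  assumes y: "y \<in> F_Z" and ij: "i < e" "e < j" and yij: "y i < y e" "y e < y j"
  shows "flen y + 3 \<le> flen (conj_transp i j y)"
proof -
  define y1 where "y1 = conj_transp i e y"
  define y2 where "y2 = conj_transp e j y1"
  have Z: "y1 \<in> F_Z" "y2 \<in> F_Z" unfolding y1_def y2_def using y by (simp_all add: conj_F_Z)
  have n: "y i \<noteq> i" "y e \<noteq> e" "y j \<noteq> j" using F_Z_neq[OF y] by auto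
  have n1: "y i \<noteq> e" "y e \<noteq> i" "y j \<noteq> i" "y i \<noteq> j" "y e \<noteq> j" "y j \<noteq> e"
    using F_Z_invol[OF y, of i] F_Z_invol[OF y, of e] F_Z_invol[OF y, of j] ij yij by auto
  have v1: "y1 e = y i" "y1 j = y j" "y1 i = y e"
    unfolding y1_def conj_transp_apply using ij n n1 by auto
  have v2: "y2 i = y e" "y2 e = y j"
    unfolding y2_def conj_transp_apply using ij n n1 v1 by auto
  have "flen y < flen y1" unfolding y1_def by (rule flen_conj_less[OF y ij(1) yij(1)])
  moreover have "flen y1 < flen y2"
    unfolding y2_def by (rule flen_conj_less[OF Z(1) ij(2)]) (use v1 yij in simp)
  moreover have "flen y2 < flen (conj_transp i e y2)"
    by (rule flen_conj_less[OF Z(2) ij(1)]) (use v2 yij in simp)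
  moreover have "conj_transp i e y2 = conj_transp i j y"
  proof -
    have t: "transpose i e (transpose e j (transpose i e k)) = transpose i j k" for k
      using ij by (auto simp: transpose_def)
    show ?thesis unfolding y2_def y1_def by (rule ext) (simp only: conj_transp_apply t)
  qed
  ultimately show ?thesis by simp
qed

text \<open>A conjugation that gives \<open>r\<close> a new partner can be described as exchanging the old and the new
  partner of \<open>r\<close>, whichever of the four points involved \<open>r\<close> is.\<close>

lemma conj_transp_moved:
  assumes y: "y \<in> F_Z" and ne: "conj_transp i j y r \<noteq> y r"
  shows "conj_transp i j y = conj_transp (y r) (conj_transp i j y r) y"
proof -
  have nij: "y i \<noteq> j" "y j \<noteq> i" using ne conj_partner_fix[OF y, of i j] F_Z_invol[OF y, of j] by auto
  have n: "y i \<noteq> i" "y j \<noteq> j" using F_Z_neq[OF y] by auto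
  consider "r = i" | "r = j" | "r = y i" | "r = y j" | "r \<notin> {i, j, y i, y j}" by blast
  then show ?thesis
  proof cases
    case 1
    then show ?thesis using nij n conj_partner[OF y, of i j] by (simp add: conj_transp_apply)
  next
    case 2
    then show ?thesis using nij n conj_partner[OF y, of j i] by (simp add: conj_transp_apply conj_transp_commute)
  next
    case 3
    then show ?thesis using nij n y by (simp add: conj_transp_apply)
  next
    case 4
    then show ?thesis using nij n y by (simp add: conj_transp_apply conj_transp_commute)
  next
    case 5
    then have "conj_transp i j y r = y r"
      using F_Z_eq_iff[OF y, of r i] F_Z_eq_iff[OF y, of r j] by (simp add: conj_transp_apply)
    with ne show ?thesis by simp
  qed
qed

section \<open>The Bruhat order is graded\<close>

lemma bruhat_step_flen:
  "bruhat_step y z \<longleftrightarrow> y \<in> F_Z \<and> (\<exists>i j. z = conj_transp i j y) \<and> flen y < flen z"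
proof
  assume s: "bruhat_step y z"
  then obtain i j where z: "y \<in> F_Z" "z = conj_transp i j y" "fpf_len y < fpf_len z"
    unfolding bruhat_step_def by blast
  have "z \<in> F_Z" unfolding z(2) by (rule conj_F_Z[OF z(1)])
  then have "flen y < flen z" using z(3) fpf_len_flen[OF z(1)] fpf_len_flen[of z] by simp
  with z show "y \<in> F_Z \<and> (\<exists>i j. z = conj_transp i j y) \<and> flen y < flen z" by blast
next
  assume "y \<in> F_Z \<and> (\<exists>i j. z = conj_transp i j y) \<and> flen y < flen z"
  then obtain i j where z: "y \<in> F_Z" "z = conj_transp i j y" "flen y < flen z" by blast
  have "z \<in> F_Z" unfolding z(2) by (rule conj_F_Z[OF z(1)])
  then have "fpf_len y < fpf_len z" using z(3) fpf_len_flen[OF z(1)] fpf_len_flen[of z] by simp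
  moreover have "i \<noteq> j"
  proof
    assume "i = j"
    then have "z = y" unfolding z(2) conj_transp_def by simp
    with z(3) show False by simp
  qed
  ultimately show "bruhat_step y z" using z unfolding bruhat_step_def by blast
qed

lemma bruhat_step_F_Z: "bruhat_step y z \<Longrightarrow> y \<in> F_Z" "bruhat_step y z \<Longrightarrow> z \<in> F_Z"
  unfolding bruhat_step_def using conj_F_Z by auto

lemma bruhat_less_F_Z: "bruhat_less y z \<Longrightarrow> y \<in> F_Z \<and> z \<in> F_Z"
  unfolding bruhat_less_def by (induction rule: tranclp_induct) (auto dest: bruhat_step_F_Z)

lemma bruhat_less_flen: "bruhat_less y z \<Longrightarrow> flen y < flen z"
  unfolding bruhat_less_def by (induction rule: tranclp_induct) (auto simp: bruhat_step_flen)

lemma bruhat_less_trans: "bruhat_less x y \<Longrightarrow> bruhat_less y z \<Longrightarrow> bruhat_less x z"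
  unfolding bruhat_less_def by (rule tranclp_trans)

lemma bruhat_step_less: "bruhat_step y z \<Longrightarrow> bruhat_less y z"
  unfolding bruhat_less_def by (rule tranclp.r_into_trancl)

lemma bruhat_le_less_trans: "bruhat_le x y \<Longrightarrow> bruhat_less y z \<Longrightarrow> bruhat_less x z"
  unfolding bruhat_le_def using bruhat_less_trans by blast

lemma bruhat_step_ascent:
  assumes "y \<in> F_Z" "y a < y (a + 1)"
  shows "bruhat_step y (conj_transp a (a + 1) y)"
  unfolding bruhat_step_flen using flen_ascent[OF assms] assms(1) by auto

lemma bruhat_step_descent:
  assumes "z \<in> F_Z" "descent z a"
  shows "bruhat_step (conj_transp a (a + 1) z) z"
  using bruhat_step_ascent[OF conj_F_Z[OF assms(1)] ascent_conj[OF assms]] by simp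

lemma bruhat_step_lift:
  assumes "bruhat_step v u" "u \<noteq> conj_transp a (a + 1) v"
  shows "bruhat_step (conj_transp a (a + 1) v) (conj_transp a (a + 1) u)"
proof -
  obtain i j where u: "v \<in> F_Z" "u = conj_transp i j v" "flen v < flen u"
    using assms(1) unfolding bruhat_step_flen by blast
  have "flen (conj_transp a (a + 1) v) < flen (conj_transp a (a + 1) u)"
    using flen_conj_lift[OF u(1), of i j a] u(3) assms(2) unfolding u(2) by blast
  moreover have "conj_transp a (a + 1) u = conj_transp (simple a i) (simple a j) (conj_transp a (a + 1) v)"
    unfolding u(2) conj_conj_simple ..
  ultimately show ?thesis unfolding bruhat_step_flen using conj_F_Z[OF u(1)] by blast
qed

text \<open>Along a chain from \<open>c\<close> to \<open>d\<close> every step can be conjugated, unless it is the step given by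
  \<open>simple a\<close> itself; at the first such step the conjugated chain meets the original one.\<close>

lemma bruhat_less_lift:
  assumes "bruhat_less c d"
  shows "bruhat_less (conj_transp a (a + 1) c) (conj_transp a (a + 1) d) \<or> bruhat_le (conj_transp a (a + 1) c) d"
  using assms[unfolded bruhat_less_def]
proof (induction rule: converse_tranclp_induct)
  case (base c)
  then show ?case using bruhat_step_lift bruhat_step_less unfolding bruhat_le_def by metis
next
  case (step c e)
  have ed: "bruhat_less e d" using step(2) by (simp add: bruhat_less_def)
  show ?case
  proof (cases "e = conj_transp a (a + 1) c")
    case True
    then show ?thesis using ed unfolding bruhat_le_def by blast
  next
    case False
    have "bruhat_less (conj_transp a (a + 1) c) (conj_transp a (a + 1) e)"
      by (rule bruhat_step_less[OF bruhat_step_lift[OF step(1) False]])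
    then show ?thesis using step(3) bruhat_less_trans unfolding bruhat_le_def by metis
  qed
qed

text \<open>Left of the first place where \<open>z\<close> and \<open>Theta\<close> differ, the cycles are those of \<open>Theta\<close>; the
  position just before the partner of that place is a descent.\<close>

lemma fpf_descent_exists:
  assumes z: "z \<in> F_Z" and ne: "z \<noteq> Theta"
  obtains a where "descent z a"
proof -
  obtain N where N: "N \<ge> 0" and far: "\<And>i. \<bar>i\<bar> > N + 1 \<Longrightarrow> z i = Theta i"
    using F_Z_window[OF z] by metis
  show ?thesis
  proof (rule ccontr)
    assume "\<not> thesis"
    then have nd: "\<not> descent z a" for a using that by blast
    \<comment> \<open>\<open>L\<close> is odd, so that \<open>Theta\<close> preserves \<open>{..<L}\<close>.\<close>
    define L where "L = - 2 * (N + 1) - 1"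
    have "\<forall>i < L + 2 * int k. z i = Theta i" for k
    proof (induction k)
      case 0
      then show ?case using far N by (auto simp: L_def)
    next
      case (Suc k)
      define b where "b = L + 2 * int k"
      have odd: "odd b" by (simp add: b_def L_def)
      have below: "z i = Theta i" "Theta i < b" if "i < b" for i
      proof -
        show "z i = Theta i" using Suc that by (simp add: b_def)
        show "Theta i < b" using that odd by (cases "i = b - 1") (auto simp: Theta_def)
      qed
      have inside: "z i \<ge> b" if "i \<ge> b" for i
        using below[of "z i"] F_Z_invol[OF z, of i] that by force
      have "z b = b + 1"
      proof (rule ccontr)
        assume c: "z b \<noteq> b + 1"
        then have c1: "z b > b + 1" using inside[of b] F_Z_neq[OF z, of b] by simp
        have "z (z b - 1) \<noteq> z (z b)" using F_Z_inj[OF z, of "z b - 1" "z b"] by simp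
        then have "z (z b - 1) > z (z b)" using inside[of "z b - 1"] c1 z by simp
        moreover have "z (z b - 1) \<noteq> z b" using F_Z_inj[OF z, of "z b - 1" b] c1 by simp
        ultimately have "descent z (z b - 1)" by (simp add: descent_def)
        with nd show False by blast
      qed
      then have "z b = Theta b" "z (b + 1) = Theta (b + 1)"
        using F_Z_invol[OF z, of b] odd by (auto simp: Theta_def)
      have "z i = Theta i" if "i < b + 2" for i
      proof -
        have "i < b \<or> i = b \<or> i = b + 1" using that by linarith
        then show ?thesis using below(1)[of i] \<open>z b = Theta b\<close> \<open>z (b + 1) = Theta (b + 1)\<close> by auto
      qed
      moreover have "L + 2 * int (Suc k) = b + 2" by (simp add: b_def)
      ultimately show ?case by simp
    qed
    note all = this
    have "z i = Theta i" for i
    proof -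
      have "i < L + 2 * int (nat (i - L + 1))" by simp
      then show ?thesis using all by blast
    qed
    then have "z = Theta" by (rule ext)
    with ne show False by contradiction
  qed
qed

text \<open>Induction on the length: if a descent of \<open>z\<close> is also one of \<open>y\<close>, it is removed from both and
  the intermediate element is lifted back; otherwise removing it from \<open>z\<close> or adding it to \<open>y\<close>
  gives an intermediate element directly.\<close>

lemma bruhat_step_refine:
  assumes "bruhat_step y z" "Suc (flen y) < flen z"
  shows "\<exists>w. bruhat_less y w \<and> bruhat_less w z"
  using assms
proof (induction "flen z" arbitrary: y z rule: less_induct)
  case less
  have Z: "y \<in> F_Z" "z \<in> F_Z" using bruhat_step_F_Z[OF less(2)] by auto
  have "z \<noteq> Theta" using less(3) by auto
  then obtain a where a: "descent z a" using fpf_descent_exists[OF Z(2)] by blast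
  let ?c = "conj_transp a (a + 1)"
  have fz: "flen z = Suc (flen (?c z))" by (rule flen_descent[OF Z(2) a])
  have zz: "bruhat_less (?c z) z" by (rule bruhat_step_less[OF bruhat_step_descent[OF Z(2) a]])
  show ?case
  proof (cases rule: F_Z_cases[OF Z(1), of a])
    case 1
    have "flen (?c y) = Suc (flen y)" by (rule flen_ascent[OF Z(1) 1])
    then have "z \<noteq> ?c y" using less(3) by auto
    then have "bruhat_less (?c y) (?c z)" by (rule bruhat_step_less[OF bruhat_step_lift[OF less(2)]])
    then have "bruhat_less (?c y) z" using zz by (rule bruhat_less_trans)
    moreover have "bruhat_less y (?c y)" by (rule bruhat_step_less[OF bruhat_step_ascent[OF Z(1) 1]])
    ultimately show ?thesis by blast
  next
    case 2
    have fy: "flen y = Suc (flen (?c y))" by (rule flen_descent[OF Z(1) 2])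
    then have "z \<noteq> ?c y" using less(3) by auto
    then have "bruhat_step (?c y) (?c z)" by (rule bruhat_step_lift[OF less(2)])
    then obtain w where w: "bruhat_less (?c y) w" "bruhat_less w (?c z)"
      using less(1)[of "?c z" "?c y"] fz fy less(3) by auto
    have low: "bruhat_less y (?c w) \<or> bruhat_le y w"
      using bruhat_less_lift[OF w(1), of a] by simp
    have up: "bruhat_less (?c w) z \<or> bruhat_le (?c w) (?c z)"
      using bruhat_less_lift[OF w(2), of a] by simp
    from low show ?thesis
    proof
      assume "bruhat_less y (?c w)"
      moreover have "bruhat_less (?c w) z" using up bruhat_le_less_trans zz by blast
      ultimately show ?thesis by blast
    next
      assume "bruhat_le y w"
      then have "bruhat_less y (?c z)" using w(2) by (rule bruhat_le_less_trans)
      then show ?thesis using zz by blast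
    qed
  next
    case 3
    have c: "?c y = y" by (rule conj_partner_fix[OF Z(1) 3])
    then have "z \<noteq> ?c y" using less(3) by auto
    then have "bruhat_less (?c y) (?c z)" by (rule bruhat_step_less[OF bruhat_step_lift[OF less(2)]])
    then have "bruhat_less y (?c z)" by (simp only: c)
    then show ?thesis using zz by blast
  qed
qed

definition covers :: "(int \<Rightarrow> int) \<Rightarrow> (int \<Rightarrow> int) set" where
  "covers y = {z. (\<exists>i j. z = conj_transp i j y) \<and> flen z = Suc (flen y)}"

text \<open>Every step raises the length, so nothing fits into a step that raises it by one; a step that
  raises it further can be refined.\<close>

lemma bruhat_cover_iff:
  assumes y: "y \<in> F_Z"
  shows "bruhat_cover y (conj_transp i j y) \<longleftrightarrow> conj_transp i j y \<in> covers y"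
proof
  let ?z = "conj_transp i j y"
  assume "bruhat_cover y ?z"
  then have c: "{w \<in> F_Z. bruhat_le y w \<and> bruhat_less w ?z} = {y}" unfolding bruhat_cover_def by (rule sym)
  then have "bruhat_less y ?z" by blast
  then have less: "flen y < flen ?z" by (rule bruhat_less_flen)
  then have step: "bruhat_step y ?z" unfolding bruhat_step_flen using y by blast
  have "\<not> Suc (flen y) < flen ?z"
  proof
    assume "Suc (flen y) < flen ?z"
    then obtain w where w: "bruhat_less y w" "bruhat_less w ?z"
      using bruhat_step_refine[OF step] by blast
    have "w \<in> {w \<in> F_Z. bruhat_le y w \<and> bruhat_less w ?z}"
      using w bruhat_less_F_Z unfolding bruhat_le_def by blast
    then have "w = y" unfolding c by simp
    with w(1) bruhat_less_irrefl show False by blast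
  qed
  then show "?z \<in> covers y" unfolding covers_def using less by auto
next
  let ?z = "conj_transp i j y"
  assume "?z \<in> covers y"
  then have f: "flen ?z = Suc (flen y)" unfolding covers_def by simp
  then have step: "bruhat_step y ?z" unfolding bruhat_step_flen using y by auto
  have "w = y" if "bruhat_le y w" "bruhat_less w ?z" for w
    using that bruhat_less_flen[of y w] bruhat_less_flen[of w ?z] f unfolding bruhat_le_def by auto
  then have "{w \<in> F_Z. bruhat_le y w \<and> bruhat_less w ?z} = {y}"
    using y bruhat_step_less[OF step] unfolding bruhat_le_def by blast
  then show "bruhat_cover y ?z" unfolding bruhat_cover_def by (rule sym)
qed

lemma covers_F_Z: "y \<in> F_Z \<Longrightarrow> z \<in> covers y \<Longrightarrow> z \<in> F_Z"
  unfolding covers_def using conj_F_Z by auto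

section \<open>Covers and conjugation by adjacent transpositions\<close>

lemma covers_step: "y \<in> F_Z \<Longrightarrow> z \<in> covers y \<Longrightarrow> bruhat_step y z"
  unfolding covers_def bruhat_step_flen by auto

lemma ascent_in_covers: "y \<in> F_Z \<Longrightarrow> y a < y (a + 1) \<Longrightarrow> conj_transp a (a + 1) y \<in> covers y"
  unfolding covers_def using flen_ascent by blast

text \<open>A cover that loses the ascent at \<open>a\<close> can only come from \<open>simple a\<close>: for any other cover \<open>z\<close>,
  lifting would make the conjugate of \<open>z\<close>, and therefore \<open>z\<close>, longer by two than \<open>y\<close>.\<close>

lemma covers_new_descent:
  assumes y: "y \<in> F_Z" and a: "y a < y (a + 1)" and z: "z \<in> covers y" and za: "z (a + 1) < z a"
  shows "z = conj_transp a (a + 1) y"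
proof (rule ccontr)
  assume ne: "z \<noteq> conj_transp a (a + 1) y"
  let ?c = "conj_transp a (a + 1)"
  have Z: "z \<in> F_Z" by (rule covers_F_Z[OF y z])
  have f: "flen z = Suc (flen y)" "flen (?c y) = Suc (flen y)"
    using z flen_ascent[OF y a] unfolding covers_def by auto
  have "flen (?c y) < flen (?c z)"
    using bruhat_step_lift[OF covers_step[OF y z] ne] unfolding bruhat_step_flen by blast
  moreover have "flen (?c z) \<le> flen z"
  proof (cases rule: F_Z_cases[OF Z, of a])
    case 1
    with za show ?thesis by simp
  next
    case 2
    then show ?thesis using flen_descent[OF Z 2] by simp
  next
    case 3
    then show ?thesis using conj_partner_fix[OF Z 3] by simp
  qed
  ultimately show False using f by simp
qed

lemma covers_cycle_no_descent:
  assumes y: "y \<in> F_Z" and a: "y a = a + 1" and z: "z \<in> covers y"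
  shows "\<not> descent z a"
proof
  let ?c = "conj_transp a (a + 1)"
  assume za: "descent z a"
  have Z: "z \<in> F_Z" by (rule covers_F_Z[OF y z])
  have f: "flen z = Suc (flen y)" using z unfolding covers_def by auto
  have c: "?c y = y" by (rule conj_partner_fix[OF y a])
  have "z \<noteq> ?c y" unfolding c using f by auto
  then have "flen (?c y) < flen (?c z)"
    using bruhat_step_lift[OF covers_step[OF y z]] unfolding bruhat_step_flen by blast
  then show False using flen_descent[OF Z za] f c by simp
qed

text \<open>Conjugation by \<open>simple a\<close> lowers the lengths of \<open>y\<close> and of its covers with a descent at \<open>a\<close> alike.
  Conversely, \<open>y\<close> is the only cover of its conjugate that loses the ascent at \<open>a\<close>, so conjugation
  raises the length of every other one.\<close>

lemma covers_descent_bij: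
  assumes y: "y \<in> F_Z" and a: "descent y a"
  defines "c \<equiv> conj_transp a (a + 1)"
  shows "bij_betw c {z \<in> covers y. descent z a} (covers (c y) - {y})"
proof (rule bij_betw_byWitness[of _ c])
  let ?v = "c y"
  have V: "?v \<in> F_Z" unfolding c_def by (rule conj_F_Z[OF y])
  have va: "?v a < ?v (a + 1)" unfolding c_def by (rule ascent_conj[OF y a])
  have cv: "c ?v = y" unfolding c_def by simp
  have fy: "flen y = Suc (flen ?v)" unfolding c_def by (rule flen_descent[OF y a])
  show "\<forall>z\<in>{z \<in> covers y. descent z a}. c (c z) = z" "\<forall>u\<in>covers (c y) - {y}. c (c u) = u"
    unfolding c_def by simp_all
  show "c ` {z \<in> covers y. descent z a} \<subseteq> covers ?v - {y}"
  proof
    fix u assume "u \<in> c ` {z \<in> covers y. descent z a}"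
    then obtain z where z: "z \<in> covers y" "descent z a" "u = c z" by blast
    obtain i j where ij: "z = conj_transp i j y" using z(1) unfolding covers_def by blast
    have "flen z = Suc (flen u)" unfolding z(3) c_def by (rule flen_descent[OF covers_F_Z[OF y z(1)] z(2)])
    then have fu: "flen u = Suc (flen ?v)" using z(1) fy unfolding covers_def by simp
    have "u = conj_transp (simple a i) (simple a j) ?v" unfolding z(3) ij c_def conj_conj_simple ..
    then have "u \<in> covers ?v" unfolding covers_def using fu by blast
    moreover have "u \<noteq> y"
    proof
      assume "u = y"
      then have "z = ?v" using z(3) unfolding c_def by (metis conj_conj)
      then show False using z(1) fy unfolding covers_def by simp
    qed
    ultimately show "u \<in> covers ?v - {y}" by blast
  qed
  show "c ` (covers ?v - {y}) \<subseteq> {z \<in> covers y. descent z a}"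
  proof
    fix z assume "z \<in> c ` (covers ?v - {y})"
    then obtain u where u: "u \<in> covers ?v" "u \<noteq> y" "z = c u" by blast
    obtain i j where ij: "u = conj_transp i j ?v" using u(1) unfolding covers_def by blast
    have U: "u \<in> F_Z" by (rule covers_F_Z[OF V u(1)])
    have "\<not> u (a + 1) < u a"
      using covers_new_descent[OF V va u(1)] u(2) cv unfolding c_def by blast
    then have ua: "u a < u (a + 1)" using F_Z_inj[OF U, of a "a + 1"] by simp
    have "flen z = Suc (flen u)" unfolding u(3) c_def by (rule flen_ascent[OF U ua])
    then have fz: "flen z = Suc (flen y)" using u(1) fy unfolding covers_def by simp
    have "z = c (conj_transp i j (c y))" unfolding u(3) ij ..
    also have "\<dots> = conj_transp (simple a i) (simple a j) y"
      unfolding c_def using conj_conj_simple[of a i j "conj_transp a (a + 1) y"] by simp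
    finally have "z \<in> covers y" unfolding covers_def using fz by blast
    moreover have "descent z a" unfolding u(3) c_def by (rule descent_conj[OF U ua])
    ultimately show "z \<in> {z \<in> covers y. descent z a}" by blast
  qed
qed

text \<open>Such a cover exchanges the partners of \<open>c = y r\<close> and \<open>d = z r\<close>. If \<open>d\<close> were far away, a fixed point
  \<open>E\<close> between \<open>c\<close> and \<open>d\<close> would raise the length by three.\<close>

lemma finite_covers_moved:
  assumes y: "y \<in> F_Z"
  shows "finite {z \<in> covers y. z r \<noteq> y r}"
proof -
  obtain N where N: "N \<ge> 0" and far: "\<And>i. \<bar>i\<bar> > N + 1 \<Longrightarrow> y i = Theta i"
    using F_Z_window[OF y] by metis
  have near: "y i - i \<le> 1" "i - y i \<le> 1" if "\<bar>i\<bar> > N + 1" for i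
    using far[OF that] by (auto simp: Theta_def)
  define c where "c = y r"
  \<comment> \<open>Beyond \<open>N + 1\<close> the involution moves points by one only, so at distance three from \<open>c\<close> and
    \<open>y c\<close> its values compare like the points.\<close>
  define E where "E = N + \<bar>c\<bar> + \<bar>y c\<bar> + 3"
  have E: "\<bar>c\<bar> + \<bar>y c\<bar> + 3 \<le> E" "N + 1 < E" using N by (auto simp: E_def)
  have nE: "y E - E \<le> 1" "E - y E \<le> 1" "y (- E) + E \<le> 1" "- E - y (- E) \<le> 1"
    using near[of E] near[of "- E"] N E(2) by auto
  have "{z \<in> covers y. z r \<noteq> y r} \<subseteq> (\<lambda>d. conj_transp c d y) ` {- E - 3..E + 3}"
  proof
    fix z assume "z \<in> {z \<in> covers y. z r \<noteq> y r}"
    then have z: "z \<in> covers y" "z r \<noteq> y r" by auto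
    define d where "d = z r"
    have zd: "z = conj_transp c d y"
      using z conj_transp_moved[OF y] unfolding covers_def c_def d_def by blast
    have fz: "flen z = Suc (flen y)" using z(1) unfolding covers_def by simp
    have "\<not> d > E + 3"
    proof
      assume d: "d > E + 3"
      have yd: "y d - d \<le> 1" "d - y d \<le> 1" using near[of d] d N E(2) by auto
      have "c < E" "E < d" "y c < y E" "y E < y d" using d nE E(1) yd by linarith+
      then have "flen y + 3 \<le> flen (conj_transp c d y)" by (rule flen_conj_between[OF y])
      then show False using fz unfolding zd by simp
    qed
    moreover have "\<not> d < - E - 3"
    proof
      assume d: "d < - E - 3"
      have yd: "y d - d \<le> 1" "d - y d \<le> 1" using near[of d] d N E(2) by auto
      have "d < - E" "- E < c" "y d < y (- E)" "y (- E) < y c" using d nE E(1) yd by linarith+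
      then have "flen y + 3 \<le> flen (conj_transp d c y)" by (rule flen_conj_between[OF y])
      then show False using fz unfolding zd conj_transp_commute[of c d] by simp
    qed
    ultimately have "d \<in> {- E - 3..E + 3}" by auto
    then show "z \<in> (\<lambda>d. conj_transp c d y) ` {- E - 3..E + 3}" unfolding zd by blast
  qed
  then show ?thesis using finite_subset by blast
qed

section \<open>Atoms\<close>

lemma conj_atom_simple: "w \<in> S_Z \<Longrightarrow>
  inv (w \<circ> simple a) \<circ> Theta \<circ> (w \<circ> simple a) = conj_transp a (a + 1) (inv w \<circ> Theta \<circ> w)"
  unfolding simple_def by (rule conj_atom[OF S_Z_bij])

text \<open>Appending an adjacent transposition to \<open>w\<close> conjugates the involution, which changes its length by
  at most one.\<close>

lemma flen_le_len: "w \<in> S_Z \<Longrightarrow> flen (inv w \<circ> Theta \<circ> w) \<le> len w"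
proof (induction w rule: S_Z_induct)
  case id
  show ?case by simp
next
  case (ascent w a)
  let ?y = "inv w \<circ> Theta \<circ> w"
  have "flen (conj_transp a (a + 1) ?y) \<le> Suc (flen ?y)"
    using flen_le[OF conj_F_Z[OF F_Z_I[OF ascent(1)], of a "a + 1"], of a] by (simp only: conj_conj)
  then show ?case
    unfolding conj_atom_simple[OF ascent(1)] len_comp_simple[OF ascent(1,2)] using ascent(3) by linarith
qed

lemma len_comp_simple_cases:
  assumes "w \<in> S_Z"
  shows "len (w \<circ> simple a) = Suc (len w) \<and> w a < w (a + 1)
    \<or> len w = Suc (len (w \<circ> simple a)) \<and> w (a + 1) < w a"
  using len_comp_simple[OF assms] len_comp_simple_desc[OF assms] S_Z_neq[OF assms, of a "a + 1"]
  by (cases "w a" "w (a + 1)" rule: linorder_cases) auto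

lemma atom_of_flen: "z \<in> F_Z \<Longrightarrow> \<exists>w\<in>S_Z. z = inv w \<circ> Theta \<circ> w \<and> len w = flen z"
proof (induction "flen z" arbitrary: z rule: less_induct)
  case less
  note z = less(2)
  show ?case
  proof (cases "z = Theta")
    case True
    then show ?thesis by (intro bexI[of _ id]) simp_all
  next
    case False
    then obtain a where a: "descent z a" using fpf_descent_exists[OF z] by blast
    let ?y = "conj_transp a (a + 1) z"
    have f: "flen z = Suc (flen ?y)" by (rule flen_descent[OF z a])
    then obtain w where w: "w \<in> S_Z" "?y = inv w \<circ> Theta \<circ> w" "len w = flen ?y"
      using less(1)[of ?y] conj_F_Z[OF z] by auto
    let ?v = "w \<circ> simple a"
    have v: "?v \<in> S_Z" by (rule S_Z_comp[OF w(1) simple_S_Z])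
    have zv: "z = inv ?v \<circ> Theta \<circ> ?v"
      unfolding conj_atom_simple[OF w(1)] w(2)[symmetric] by (rule conj_conj[symmetric])
    have "flen z \<le> len ?v" using flen_le_len[OF v] by (simp only: zv[symmetric])
    then have "len ?v = flen z" using len_comp_simple_cases[OF w(1), of a] w(3) f by linarith
    with v zv show ?thesis by blast
  qed
qed

text \<open>The lower bound for the length is attained, because the descents of \<open>z\<close> can be removed one by one
  until \<open>Theta\<close> is reached.\<close>

lemma A_FPF_iff:
  assumes z: "z \<in> F_Z"
  shows "w \<in> A_FPF z \<longleftrightarrow> w \<in> S_Z \<and> z = inv w \<circ> Theta \<circ> w \<and> len w = flen z"
proof
  assume w: "w \<in> A_FPF z"
  obtain v where v: "v \<in> S_Z" "z = inv v \<circ> Theta \<circ> v" "len v = flen z" using atom_of_flen[OF z] by blast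
  have 1: "w \<in> S_Z" "z = inv w \<circ> Theta \<circ> w" using w unfolding A_FPF_def by blast+
  have "len w \<le> flen z" using w v unfolding A_FPF_def by force
  moreover have "flen z \<le> len w" using flen_le_len[OF 1(1)] by (simp only: 1(2)[symmetric])
  ultimately show "w \<in> S_Z \<and> z = inv w \<circ> Theta \<circ> w \<and> len w = flen z" using 1 by simp
next
  assume w: "w \<in> S_Z \<and> z = inv w \<circ> Theta \<circ> w \<and> len w = flen z"
  have "len w \<le> len v" if "v \<in> S_Z" "z = inv v \<circ> Theta \<circ> v" for v
    using flen_le_len[OF that(1)] w by (simp only: that(2)[symmetric])
  then show "w \<in> A_FPF z" unfolding A_FPF_def using w by blast
qed

lemma atom_descent:
  assumes z: "z \<in> F_Z" and w: "w \<in> A_FPF z" and d: "w (a + 1) < w a"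
  shows "descent z a \<and> w \<circ> simple a \<in> A_FPF (conj_transp a (a + 1) z)"
proof -
  let ?v = "w \<circ> simple a" and ?y = "conj_transp a (a + 1) z"
  have w': "w \<in> S_Z" "z = inv w \<circ> Theta \<circ> w" "len w = flen z" using w unfolding A_FPF_iff[OF z] by auto
  have v: "?v \<in> S_Z" by (rule S_Z_comp[OF w'(1) simple_S_Z])
  have yv: "?y = inv ?v \<circ> Theta \<circ> ?v" unfolding conj_atom_simple[OF w'(1)] w'(2)[symmetric] ..
  have l: "len w = Suc (len ?v)" by (rule len_comp_simple_desc[OF w'(1) d])
  have "flen ?y \<le> len ?v" using flen_le_len[OF v] by (simp only: yv[symmetric])
  then have f: "flen ?y < flen z" using l w'(3) by linarith
  have "descent z a"
  proof (cases rule: F_Z_cases[OF z, of a])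
    case 1
    then show ?thesis using f flen_ascent[OF z 1] by simp
  next
    case 3
    then show ?thesis using f conj_partner_fix[OF z 3] by simp
  qed
  moreover from this have "len ?v = flen ?y" using flen_descent[OF z, of a] l w'(3) by linarith
  ultimately show ?thesis unfolding A_FPF_iff[OF conj_F_Z[OF z]] using v yv by blast
qed

lemma atom_ascent:
  assumes z: "z \<in> F_Z" and a: "descent z a" and v: "v \<in> A_FPF (conj_transp a (a + 1) z)"
  shows "v \<circ> simple a \<in> A_FPF z \<and> (v \<circ> simple a) (a + 1) < (v \<circ> simple a) a"
proof -
  let ?w = "v \<circ> simple a" and ?y = "conj_transp a (a + 1) z"
  have v': "v \<in> S_Z" "?y = inv v \<circ> Theta \<circ> v" "len v = flen ?y"
    using v unfolding A_FPF_iff[OF conj_F_Z[OF z]] by auto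
  have w: "?w \<in> S_Z" by (rule S_Z_comp[OF v'(1) simple_S_Z])
  have zw: "z = inv ?w \<circ> Theta \<circ> ?w"
    unfolding conj_atom_simple[OF v'(1)] v'(2)[symmetric] by (rule conj_conj[symmetric])
  have "flen z \<le> len ?w" using flen_le_len[OF w] by (simp only: zw[symmetric])
  then have "len ?w = flen z \<and> v a < v (a + 1)"
    using len_comp_simple_cases[OF v'(1), of a] v'(3) flen_descent[OF z a] by linarith
  then show ?thesis unfolding A_FPF_iff[OF z] using w zw by simp
qed

lemma finite_A_FPF: "z \<in> F_Z \<Longrightarrow> finite (A_FPF z)"
proof (induction "flen z" arbitrary: z rule: less_induct)
  case less
  note z = less(2)
  let ?I = "\<lambda>a. (\<lambda>v. v \<circ> simple a) ` A_FPF (conj_transp a (a + 1) z)"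
  have "A_FPF z \<subseteq> insert id (\<Union>a\<in>{a. descent z a}. ?I a)"
  proof
    fix w assume w: "w \<in> A_FPF z"
    then have wZ: "w \<in> S_Z" unfolding A_FPF_iff[OF z] by simp
    show "w \<in> insert id (\<Union>a\<in>{a. descent z a}. ?I a)"
    proof (cases "w = id")
      case False
      then obtain a where a: "w (a + 1) < w a" using descent_exists[OF wZ] by blast
      have "w = (w \<circ> simple a) \<circ> simple a" by (simp add: comp_assoc)
      then have "w \<in> ?I a" using atom_descent[OF z w a] by blast
      then show ?thesis using atom_descent[OF z w a] by blast
    qed simp
  qed
  moreover have "finite (?I a)" if "descent z a" for a
    using less(1)[of "conj_transp a (a + 1) z"] flen_descent[OF z that] conj_F_Z[OF z] by simp
  ultimately show ?case using finite_descents[OF z] finite_subset by (metis (no_types, lifting)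
      finite.insertI finite_UN_I mem_Collect_eq)
qed

lemma F_inf_F_Z: "z \<in> F_inf \<Longrightarrow> z \<in> F_Z"
  unfolding F_inf_def F_Z_def using S_inf_S_Z by blast

lemma F_inf_nonpos: "z \<in> F_inf \<Longrightarrow> i \<le> 0 \<Longrightarrow> z i = Theta i"
proof -
  assume z: "z \<in> F_inf" and i: "i \<le> 0"
  then obtain w where w: "w \<in> S_inf" "z = inv w \<circ> Theta \<circ> w" unfolding F_inf_def by blast
  have "Theta i \<le> 0" using i by (cases "i = 0") (auto simp: Theta_def)
  then have "inv w (Theta i) = Theta i" using S_inf_fix[OF inv_S_inf[OF w(1)]] by blast
  then show ?thesis using S_inf_fix[OF w(1) i] by (simp add: w(2))
qed

lemma F_inf_pos: "z \<in> F_inf \<Longrightarrow> 1 \<le> i \<Longrightarrow> 1 \<le> z i"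
proof (rule ccontr)
  assume z: "z \<in> F_inf" "1 \<le> i" "\<not> 1 \<le> z i"
  then have "z (z i) = Theta (z i)" by (intro F_inf_nonpos) auto
  then have "i = Theta (z i)" using F_inf_F_Z[OF z(1)] by simp
  with z show False by (cases "z i = 0") (auto simp: Theta_def split: if_splits)
qed

lemma F_inf_descent: "z \<in> F_inf \<Longrightarrow> descent z a \<Longrightarrow> 1 \<le> a"
proof (rule ccontr)
  assume z: "z \<in> F_inf" "descent z a" "\<not> 1 \<le> a"
  have za: "z a = Theta a" using F_inf_nonpos z by simp
  show False
  proof (cases "a = 0")
    case True
    then show False using F_inf_pos[OF z(1), of 1] za z(2) by (simp add: descent_def Theta_def)
  next
    case False
    then have "z (a + 1) = Theta (a + 1)" using F_inf_nonpos[OF z(1), of "a + 1"] z(3) by simp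
    then show False using za z(2) by (auto simp: descent_def Theta_def split: if_splits)
  qed
qed

lemma F_inf_conj: "1 \<le> a \<Longrightarrow> z \<in> F_inf \<Longrightarrow> conj_transp a (a + 1) z \<in> F_inf"
proof -
  assume a: "1 \<le> a" and z: "z \<in> F_inf"
  then obtain w where w: "w \<in> S_inf" "z = inv w \<circ> Theta \<circ> w" unfolding F_inf_def by blast
  have "w \<circ> simple a \<in> S_inf" by (rule S_inf_comp[OF w(1) simple_S_inf[OF a]])
  then have "inv (w \<circ> simple a) \<circ> Theta \<circ> (w \<circ> simple a) \<in> F_inf" unfolding F_inf_def by blast
  then show ?thesis unfolding conj_atom_simple[OF S_inf_S_Z[OF w(1)]] w(2) .
qed

lemma F_inf_conj_iff: "1 \<le> a \<Longrightarrow> conj_transp a (a + 1) z \<in> F_inf \<longleftrightarrow> z \<in> F_inf"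
  using F_inf_conj[of a z] F_inf_conj[of a "conj_transp a (a + 1) z"] by (simp only: conj_conj) blast

text \<open>A descent of an atom is a descent of \<open>z\<close>, hence positive, so the atom is a product of
  \<open>simple a\<close> with positive \<open>a\<close>.\<close>

lemma A_FPF_S_inf: "z \<in> F_inf \<Longrightarrow> w \<in> A_FPF z \<Longrightarrow> w \<in> S_inf"
proof (induction "flen z" arbitrary: z w rule: less_induct)
  case less
  have z: "z \<in> F_Z" by (rule F_inf_F_Z[OF less(2)])
  have wZ: "w \<in> S_Z" using less(3) unfolding A_FPF_iff[OF z] by simp
  show ?case
  proof (cases "w = id")
    case False
    then obtain a where a: "w (a + 1) < w a" using descent_exists[OF wZ] by blast
    note d = atom_descent[OF z less(3) a]
    then have a1: "1 \<le> a" using F_inf_descent[OF less(2)] by blast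
    have "w \<circ> simple a \<in> S_inf"
      by (rule less(1)[of "conj_transp a (a + 1) z"])
        (use d flen_descent[OF z, of a] F_inf_conj[OF a1 less(2)] in auto)
    then have "(w \<circ> simple a) \<circ> simple a \<in> S_inf" by (rule S_inf_comp[OF _ simple_S_inf[OF a1]])
    then show ?thesis by (simp add: comp_assoc)
  qed simp
qed

section \<open>The polynomials of fixed-point-free involutions\<close>

text \<open>The summands of atoms with an ascent at \<open>a\<close> are annihilated. Appending \<open>simple a\<close> maps the atoms
  with a descent at \<open>a\<close> bijectively to the atoms of the conjugate, and there are such atoms only if
  \<open>a\<close> is a descent of \<open>z\<close>.\<close>

lemma ddiff_fpf_schubert:
  assumes z: "z \<in> F_Z" and a: "1 \<le> a"
  shows "ddiff a (fpf_schubert z) = (if descent z a then fpf_schubert (conj_transp a (a + 1) z) else 0)"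
proof (cases "z \<in> F_inf")
  case False
  then show ?thesis using F_inf_conj_iff[OF a, of z] by (simp add: fpf_schubert_def)
next
  case True
  let ?y = "conj_transp a (a + 1) z" and ?D = "{w \<in> A_FPF z. w (a + 1) < w a}"
  have "ddiff a (fpf_schubert z)
      = (\<Sum>w\<in>A_FPF z. if w (a + 1) < w a then schubert (w \<circ> simple a) else 0)"
    using True A_FPF_S_inf[OF True] a
    by (simp add: fpf_schubert_def ddiff_sum ddiff_schubert cong: sum.cong)
  also have "\<dots> = (\<Sum>w\<in>?D. schubert (w \<circ> simple a))"
    by (rule sum.inter_filter[symmetric, OF finite_A_FPF[OF z]])
  also have "\<dots> = (if descent z a then fpf_schubert ?y else 0)"
  proof (cases "descent z a")
    case False
    then have "?D = {}" using atom_descent[OF z] by blast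
    then show ?thesis using False by (simp only: sum.empty if_False)
  next
    case d: True
    have ss: "(w \<circ> simple a) \<circ> simple a = w" for w :: "int \<Rightarrow> int" by (simp add: comp_assoc)
    have "(\<Sum>w\<in>?D. schubert (w \<circ> simple a)) = (\<Sum>v\<in>A_FPF ?y. schubert v)"
    proof (rule sum.reindex_bij_witness[of _ "\<lambda>v. v \<circ> simple a" "\<lambda>w. w \<circ> simple a"])
      show "(w \<circ> simple a) \<circ> simple a = w" for w :: "int \<Rightarrow> int" by (rule ss)
      show "(w \<circ> simple a) \<circ> simple a = w" for w :: "int \<Rightarrow> int" by (rule ss)
      show "w \<circ> simple a \<in> A_FPF ?y" if "w \<in> ?D" for w
        using that atom_descent[OF z] by blast
      show "v \<circ> simple a \<in> ?D" if "v \<in> A_FPF ?y" for v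
        using atom_ascent[OF z d that] by blast
    qed (rule refl)
    then show ?thesis using d F_inf_conj[OF a True] by (simp add: fpf_schubert_def)
  qed
  finally show ?thesis .
qed

lemma fpf_schubert_in_vars: "z \<in> F_Z \<Longrightarrow> in_vars {1..} (fpf_schubert z)"
  unfolding fpf_schubert_def using in_vars_of_int[of "{1..}" 0] A_FPF_S_inf
  by (auto intro!: in_vars_sum schubert_in_vars)

lemma fpf_schubert_vanishing:
  assumes "z \<in> F_Z" "0 < flen z"
  shows "vanishing (fpf_schubert z)"
proof (cases "z \<in> F_inf")
  case True
  have "vanishing (schubert w)" if "w \<in> A_FPF z" for w
  proof (rule schubert_vanishing[OF A_FPF_S_inf[OF True that]])
    have "len w = flen z" using that unfolding A_FPF_iff[OF assms(1)] by simp
    then show "w \<noteq> id" using assms(2) by auto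
  qed
  then show ?thesis using True by (simp add: fpf_schubert_def vanishing_sum)
qed (simp add: fpf_schubert_def)

section \<open>Signed sums over covers\<close>

text \<open>For a cycle \<open>{p, q}\<close>, the sum of \<open>cover_sum y p\<close> and \<open>cover_sum y q\<close> is twice the right-hand
  side of the transition formula: a cover that moves both partners up or both down is counted
  twice with the same sign, and the covers that move them in opposite directions cancel.\<close>

definition cover_sum :: "(int \<Rightarrow> int) \<Rightarrow> int \<Rightarrow> zpoly" where
  "cover_sum y r = (\<Sum>z\<in>{z \<in> covers y. z r \<noteq> y r}. of_int (sgn (z r - y r)) * fpf_schubert z)"

lemma ddiff_cover_sum:
  assumes y: "y \<in> F_Z" and a: "1 \<le> a"
  shows "ddiff a (cover_sum y r) = (\<Sum>z\<in>{z \<in> covers y. z r \<noteq> y r \<and> descent z a}.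
      of_int (sgn (z r - y r)) * fpf_schubert (conj_transp a (a + 1) z))"
proof -
  let ?M = "{z \<in> covers y. z r \<noteq> y r}"
  have "ddiff a (cover_sum y r) = (\<Sum>z\<in>?M. if descent z a then
      of_int (sgn (z r - y r)) * fpf_schubert (conj_transp a (a + 1) z) else 0)"
    unfolding cover_sum_def ddiff_sum
    by (rule sum.cong[OF refl]) (use covers_F_Z[OF y] a in \<open>simp add: ddiff_of_int_mult ddiff_fpf_schubert\<close>)
  also have "\<dots> = (\<Sum>z\<in>{z \<in> ?M. descent z a}. of_int (sgn (z r - y r)) * fpf_schubert (conj_transp a (a + 1) z))"
    by (rule sum.inter_filter[symmetric, OF finite_covers_moved[OF y]])
  also have "{z \<in> ?M. descent z a} = {z \<in> covers y. z r \<noteq> y r \<and> descent z a}" by blast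
  finally show ?thesis .
qed

lemma sgn_simple:
  assumes "{i, j} \<noteq> {a, a + 1}"
  shows "sgn (simple a i - simple a j) = sgn (i - j)"
  using simple_less_iff[OF assms] simple_less_iff[of j i a] assms
  by (auto simp: sgn_if insert_commute)

text \<open>The covers of \<open>y\<close> that contribute correspond to the covers of \<open>v\<close> other than \<open>y\<close>, which gives the
  correction term. Their signs agree: \<open>simple a\<close> would change the sign only if \<open>z r\<close> and \<open>y r\<close> were
  \<open>a\<close> and \<open>a + 1\<close>, but then \<open>z\<close> would be \<open>v\<close>, which is shorter than \<open>y\<close>.\<close>

lemma ddiff_cover_sum_descent:
  assumes y: "y \<in> F_Z" and a: "1 \<le> a" and d: "descent y a"
  defines "v \<equiv> conj_transp a (a + 1) y" and "s \<equiv> simple a"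
  shows "ddiff a (cover_sum y r) = cover_sum v (s r) - of_int (sgn (y (s r) - v (s r))) * fpf_schubert y"
proof -
  let ?c = "conj_transp a (a + 1)"
  have V: "v \<in> F_Z" unfolding v_def by (rule conj_F_Z[OF y])
  have fy: "flen y = Suc (flen v)" unfolding v_def by (rule flen_descent[OF y d])
  have bij: "bij_betw ?c {z \<in> covers y. descent z a} (covers v - {y})"
    unfolding v_def by (rule covers_descent_bij[OF y d])
  let ?M = "{z \<in> covers y. z r \<noteq> y r \<and> descent z a}" and ?K = "{u \<in> covers v. u (s r) \<noteq> v (s r)}"
  have sval: "?c z (s r) = s (z r)" for z unfolding s_def conj_transp_simple_apply by simp
  have seq: "s i = s j \<longleftrightarrow> i = j" for i j unfolding s_def using simple_simps(4)[of a] by metis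
  have bij': "bij_betw ?c ?M (?K - {y})"
  proof (rule bij_betw_subset[OF bij, THEN bij_betw_cong[THEN iffD1, rotated]])
    show "?M \<subseteq> {z \<in> covers y. descent z a}" by blast
    show "?c ` ?M = ?K - {y}"
    proof
      show "?c ` ?M \<subseteq> ?K - {y}"
      proof
        fix u assume "u \<in> ?c ` ?M"
        then obtain z where z: "z \<in> covers y" "z r \<noteq> y r" "descent z a" "u = ?c z" by blast
        have "u \<in> covers v - {y}" using bij_betw_imp_surj_on[OF bij] z by blast
        moreover have "u (s r) \<noteq> v (s r)" unfolding z(4) v_def sval seq by (rule z(2))
        ultimately show "u \<in> ?K - {y}" by blast
      qed
      show "?K - {y} \<subseteq> ?c ` ?M"
      proof
        fix u assume u: "u \<in> ?K - {y}"
        then have "u \<in> ?c ` {z \<in> covers y. descent z a}" unfolding bij_betw_imp_surj_on[OF bij] by blast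
        then obtain z where z: "z \<in> covers y" "descent z a" "u = ?c z" by blast
        have "u (s r) \<noteq> v (s r)" using u by blast
        then have "z r \<noteq> y r" unfolding z(3) v_def sval seq .
        with z show "u \<in> ?c ` ?M" by blast
      qed
    qed
  qed (rule refl)
  have sg: "sgn (?c z (s r) - v (s r)) = sgn (z r - y r)" if "z \<in> ?M" for z
  proof -
    have z: "z \<in> covers y" "z r \<noteq> y r" using that by auto
    obtain i j where ij: "z = conj_transp i j y" using z(1) unfolding covers_def by blast
    have zc: "z = conj_transp (y r) (z r) y"
      using conj_transp_moved[OF y, of i j r] z(2) unfolding ij by blast
    have "{z r, y r} \<noteq> {a, a + 1}"
    proof
      assume "{z r, y r} = {a, a + 1}"
      then have "z r = a \<and> y r = a + 1 \<or> z r = a + 1 \<and> y r = a" by (auto simp: doubleton_eq_iff)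
      then have "z = v" using zc conj_transp_commute[of a "a + 1" y] unfolding v_def by metis
      then show False using z(1) fy unfolding covers_def by simp
    qed
    then show ?thesis unfolding v_def sval unfolding s_def by (rule sgn_simple)
  qed
  have "ddiff a (cover_sum y r) = (\<Sum>z\<in>?M. of_int (sgn (?c z (s r) - v (s r))) * fpf_schubert (?c z))"
    unfolding ddiff_cover_sum[OF y a] by (rule sum.cong[OF refl]) (simp only: sg)
  also have "\<dots> = (\<Sum>u\<in>?K - {y}. of_int (sgn (u (s r) - v (s r))) * fpf_schubert u)"
    by (rule sum.reindex_bij_betw[OF bij'])
  also have "\<dots> = cover_sum v (s r) - of_int (sgn (y (s r) - v (s r))) * fpf_schubert y"
  proof (cases "y (s r) = v (s r)")
    case True
    then have "?K - {y} = ?K" by auto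
    then show ?thesis using True by (simp add: cover_sum_def)
  next
    case False
    have "y \<in> covers v" using ascent_in_covers[OF V, of a] ascent_conj[OF y d] unfolding v_def by simp
    then have "y \<in> ?K" using False by blast
    then show ?thesis
      unfolding cover_sum_def by (simp add: sum_diff1[OF finite_covers_moved[OF V]])
  qed
  finally show ?thesis .
qed

lemma ddiff_cover_sum_ascent:
  assumes y: "y \<in> F_Z" and a: "1 \<le> a" and asc: "y a < y (a + 1)"
  defines "v \<equiv> conj_transp a (a + 1) y"
  shows "ddiff a (cover_sum y r) = of_int (sgn (v r - y r)) * fpf_schubert y"
proof -
  have vc: "v \<in> covers y" unfolding v_def by (rule ascent_in_covers[OF y asc])
  have dv: "descent v a" unfolding v_def by (rule descent_conj[OF y asc])
  have cv: "conj_transp a (a + 1) v = y" unfolding v_def by (rule conj_conj)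
  have only: "z = v" if "z \<in> covers y" "descent z a" for z
    unfolding v_def by (rule covers_new_descent[OF y asc that(1)]) (use that(2) in \<open>simp add: descent_def\<close>)
  show ?thesis
  proof (cases "v r = y r")
    case True
    then have "{z \<in> covers y. z r \<noteq> y r \<and> descent z a} = {}" using only by blast
    then show ?thesis using True by (simp only: ddiff_cover_sum[OF y a] sum.empty) simp
  next
    case False
    then have "{z \<in> covers y. z r \<noteq> y r \<and> descent z a} = {v}" using vc dv only by blast
    then show ?thesis unfolding ddiff_cover_sum[OF y a] by (simp add: cv)
  qed
qed

lemma ddiff_cover_sum_cycle:
  assumes y: "y \<in> F_Z" and a: "1 \<le> a" and c: "y a = a + 1"
  shows "ddiff a (cover_sum y r) = 0"
proof -
  have "{z \<in> covers y. z r \<noteq> y r \<and> descent z a} = {}" using covers_cycle_no_descent[OF y c] by blast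
  then show ?thesis unfolding ddiff_cover_sum[OF y a] by (simp only: sum.empty)
qed

lemma cover_sum_vanishing: "y \<in> F_Z \<Longrightarrow> vanishing (cover_sum y r)"
  unfolding cover_sum_def
proof (rule vanishing_sum)
  fix z assume y: "y \<in> F_Z" and "z \<in> {z \<in> covers y. z r \<noteq> y r}"
  then have z: "z \<in> covers y" by blast
  then have "0 < flen z" unfolding covers_def by simp
  then show "vanishing (of_int (sgn (z r - y r)) * fpf_schubert z)"
    by (intro vanishing_of_int_mult fpf_schubert_vanishing covers_F_Z[OF y z])
qed

text \<open>The integer \<open>ddiff a (X j)\<close>.\<close>

definition root_coeff :: "int \<Rightarrow> int \<Rightarrow> int" where
  "root_coeff a j = (if j = a then 1 else 0) - (if j = a + 1 then 1 else 0)"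

text \<open>The correction terms of both partners of a cycle add up to the term of the Leibniz rule in which
  \<open>X p + X (y p)\<close> is differentiated. Likewise for an ascent, where the cover \<open>v\<close> alone contributes.\<close>

lemma sgn_descent:
  assumes y: "y \<in> F_Z" and d: "descent y a"
  defines "v \<equiv> conj_transp a (a + 1) y" and "s \<equiv> simple a"
  shows "sgn (y (s p) - v (s p)) + sgn (y (s (y p)) - v (s (y p)))
    = - 2 * (root_coeff a p + root_coeff a (y p))"
proof -
  define q where "q = y p"
  have yq: "y q = p" unfolding q_def using y by simp
  have vs: "v (s p) = s q" "v (s q) = s p"
    unfolding v_def s_def conj_transp_simple_apply q_def using y by simp_all
  have da: "y (a + 1) < y a" "y a \<noteq> a + 1" using d by (simp_all add: descent_def)
  have ya: "y a \<noteq> a" "y (a + 1) \<noteq> a" "y (a + 1) \<noteq> a + 1"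
    using da F_Z_neq[OF y] F_Z_invol[OF y, of "a + 1"] by force+
  have main: "sgn (y (s p) - s q) + sgn (y (s q) - s p) = - 2 * (root_coeff a p + root_coeff a q)"
    if "p \<in> {a, a + 1}" "y p = q" "y q = p" for p q
  proof -
    have qn: "q \<noteq> a" "q \<noteq> a + 1" using that ya da by auto
    then have sq: "s q = q" unfolding s_def by (rule simple_other)
    from that(1) consider "p = a" | "p = a + 1" by blast
    then show ?thesis
      by cases (use that(2,3) da qn in \<open>simp_all add: sq[unfolded s_def] root_coeff_def s_def\<close>)
  qed
  show ?thesis unfolding q_def[symmetric] vs
  proof (cases "p \<in> {a, a + 1} \<or> q \<in> {a, a + 1}")
    case True
    then show "sgn (y (s p) - s q) + sgn (y (s q) - s p) = - 2 * (root_coeff a p + root_coeff a q)" (is ?goal)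
    proof
      assume "p \<in> {a, a + 1}"
      then show ?goal by (rule main[OF _ q_def[symmetric] yq])
    next
      assume "q \<in> {a, a + 1}"
      from main[OF this yq q_def[symmetric]] show ?goal by (simp only: add.commute)
    qed
  next
    case False
    then have "s p = p" "s q = q" unfolding s_def by (auto intro: simple_other)
    then show "sgn (y (s p) - s q) + sgn (y (s q) - s p) = - 2 * (root_coeff a p + root_coeff a q)"
      using False yq q_def[symmetric] by (simp add: root_coeff_def)
  qed
qed

lemma sgn_ascent:
  assumes y: "y \<in> F_Z" and asc: "y a < y (a + 1)"
  defines "v \<equiv> conj_transp a (a + 1) y"
  shows "sgn (v p - y p) + sgn (v (y p) - y (y p)) = 2 * (root_coeff a p + root_coeff a (y p))"
proof -
  have V: "v \<in> F_Z" unfolding v_def by (rule conj_F_Z[OF y])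
  have cv: "conj_transp a (a + 1) v = y" unfolding v_def by (rule conj_conj)
  have ya: "y a \<noteq> a" "y a \<noteq> a + 1" "y (a + 1) \<noteq> a" "y (a + 1) \<noteq> a + 1"
    using asc F_Z_neq[OF y] F_Z_invol[OF y, of a] F_Z_invol[OF y, of "a + 1"] by force+
  define q where "q = y p"
  have yq: "y q = p" unfolding q_def using y by simp
  have main: "sgn (v p - q) + sgn (v q - p) = 2 * (root_coeff a p + root_coeff a q)"
    if "p \<in> {a, a + 1}" "y p = q" "y q = p" for p q
  proof -
    have qn: "q \<noteq> a" "q \<noteq> a + 1" using that ya by auto
    then have sq: "simple a q = q" by (rule simple_other)
    have sy: "simple a (y a) = y a" "simple a (y (a + 1)) = y (a + 1)" using ya by (auto intro: simple_other)
    from that(1) consider "p = a" | "p = a + 1" by blast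
    then show ?thesis
      by cases (use that(2,3) asc qn in \<open>simp_all add: sq sy root_coeff_def v_def conj_transp_simple_apply\<close>)
  qed
  show ?thesis unfolding q_def[symmetric] yq
  proof (cases "p \<in> {a, a + 1} \<or> q \<in> {a, a + 1}")
    case True
    then show "sgn (v p - q) + sgn (v q - p) = 2 * (root_coeff a p + root_coeff a q)" (is ?goal)
    proof
      assume "p \<in> {a, a + 1}"
      then show ?goal by (rule main[OF _ q_def[symmetric] yq])
    next
      assume "q \<in> {a, a + 1}"
      from main[OF this yq q_def[symmetric]] show ?goal by (simp only: add.commute)
    qed
  next
    case False
    then have "simple a p = p" "simple a q = q" by (auto intro: simple_other)
    then show "sgn (v p - q) + sgn (v q - p) = 2 * (root_coeff a p + root_coeff a q)"
      using False yq q_def[symmetric] by (simp add: root_coeff_def v_def conj_transp_simple_apply)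
  qed
qed

text \<open>Twice the transition formula, in a form that is symmetric in the partners of the cycle. Both sides
  vanish at the origin, so it suffices to compare their divided differences, which reduce to the
  formula for the shorter involutions \<open>conj_transp a (a + 1) y\<close>.\<close>

lemma doubled_transition:
  assumes "y \<in> F_inf" "1 \<le> p"
  shows "of_int 2 * ((X p + X (y p)) * fpf_schubert y) = cover_sum y p + cover_sum y (y p)"
  using assms
proof (induction "flen y" arbitrary: y p rule: less_induct)
  case less
  have y: "y \<in> F_Z" by (rule F_inf_F_Z[OF less(2)])
  define q where "q = y p"
  have yq: "y q = p" unfolding q_def using y by simp
  have q: "1 \<le> q" unfolding q_def by (rule F_inf_pos[OF less(2,3)])
  let ?S = "fpf_schubert"
  define f where "f = of_int 2 * ((X p + X q) * ?S y) - (cover_sum y p + cover_sum y q)"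
  have "f = 0"
  proof (rule vanishing_ddiff_imp_0)
    have "vanishing (?S y * (X p + X q))"
      by (intro vanishing_mult vanishing_add vanishing_X fpf_schubert_in_vars less(3) q y)
    then show "vanishing f"
      unfolding f_def
      by (intro vanishing_diff vanishing_add cover_sum_vanishing[OF y] vanishing_of_int_mult)
        (simp add: mult.commute)
  next
    fix a :: int assume a: "1 \<le> a"
    let ?s = "simple a" and ?v = "conj_transp a (a + 1) y" and ?e = "root_coeff a p + root_coeff a q"
    have X: "ddiff a (X p + X q) = of_int ?e"
      by (simp only: ddiff_add ddiff_X root_coeff_def of_int_add)
    have lhs: "ddiff a ((X p + X q) * ?S y) = of_int ?e * ?S y + (X (?s p) + X (?s q)) * ddiff a (?S y)"
      unfolding ddiff_mult X by (simp only: act_add act_X)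
    have "ddiff a f = of_int 2 * ddiff a ((X p + X q) * ?S y)
        - (ddiff a (cover_sum y p) + ddiff a (cover_sum y q))"
      unfolding f_def by (simp only: ddiff_diff ddiff_add ddiff_of_int_mult)
    also have "\<dots> = 0"
    proof (cases rule: F_Z_cases[OF y, of a])
      case 1
      have "ddiff a (?S y) = 0" using ddiff_fpf_schubert[OF y a] 1 by (simp add: descent_def)
      moreover have "sgn (?v p - y p) + sgn (?v q - y q) = 2 * ?e"
        using sgn_ascent[OF y 1, of p] unfolding q_def .
      then have "(of_int (sgn (?v p - y p)) + of_int (sgn (?v q - y q)) :: zpoly) = of_int (2 * ?e)"
        by (simp only: of_int_add[symmetric])
      ultimately show ?thesis
        unfolding lhs ddiff_cover_sum_ascent[OF y a 1] distrib_right[symmetric] by simp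
    next
      case 2
      have dS: "ddiff a (?S y) = ?S ?v" using ddiff_fpf_schubert[OF y a] 2 by simp
      have vs: "?v (?s p) = ?s q" unfolding conj_transp_simple_apply q_def by simp
      have IH: "of_int 2 * ((X (?s p) + X (?s q)) * ?S ?v) = cover_sum ?v (?s p) + cover_sum ?v (?s q)"
        using less(1)[of ?v "?s p"] flen_descent[OF y 2] F_inf_conj[OF a less(2)]
          S_inf_pos[OF simple_S_inf[OF a] less(3)] unfolding vs by simp
      have "sgn (y (?s p) - ?v (?s p)) + sgn (y (?s q) - ?v (?s q)) = - 2 * ?e"
        using sgn_descent[OF y 2, of p] unfolding q_def .
      then have sg: "(of_int (sgn (y (?s p) - ?v (?s p))) + of_int (sgn (y (?s q) - ?v (?s q))) :: zpoly)
          = of_int (- 2 * ?e)"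
        by (simp only: of_int_add[symmetric])
      have "of_int 2 * (of_int ?e * ?S y + (X (?s p) + X (?s q)) * ?S ?v)
          = of_int 2 * (of_int ?e * ?S y) + (cover_sum ?v (?s p) + cover_sum ?v (?s q))"
        unfolding distrib_left IH ..
      also have "\<dots> = cover_sum ?v (?s p) + cover_sum ?v (?s q) - of_int (- 2 * ?e) * ?S y"
        by (simp add: algebra_simps)
      also have "\<dots> = (cover_sum ?v (?s p) - of_int (sgn (y (?s p) - ?v (?s p))) * ?S y)
          + (cover_sum ?v (?s q) - of_int (sgn (y (?s q) - ?v (?s q))) * ?S y)"
        unfolding sg[symmetric] distrib_right by simp
      finally show ?thesis
        unfolding lhs dS ddiff_cover_sum_descent[OF y a 2] by simp
    next
      case 3
      have "ddiff a (?S y) = 0" using ddiff_fpf_schubert[OF y a] 3 by (simp add: descent_def)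
      moreover have "?e = 0"
      proof -
        have "y (a + 1) = a" using F_Z_invol[OF y, of a] unfolding 3 .
        then have "q = a + 1 \<longleftrightarrow> p = a" "q = a \<longleftrightarrow> p = a + 1"
          using F_Z_inj[OF y, of p a] F_Z_inj[OF y, of p "a + 1"] 3 unfolding q_def by simp_all
        then show ?thesis unfolding root_coeff_def by simp
      qed
      ultimately show ?thesis unfolding lhs ddiff_cover_sum_cycle[OF y a 3] by simp
    qed
    finally show "ddiff a f = 0" .
  qed
  then show ?case unfolding f_def q_def by simp
qed

section \<open>The transition formula\<close>

text \<open>By definition \<open>p\<close> is moved up; that its partner is moved up as well expresses that the length
  grows. Conversely, a cover moving \<open>p\<close> to \<open>j\<close> exchanges the partners of \<open>q\<close> and \<open>j\<close>.\<close>

lemma Psi_plus_eq: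
  assumes y: "y \<in> F_Z" and pq: "y p = q" "p < q"
  shows "Psi_plus y q = {z \<in> {z \<in> covers y. z p \<noteq> q}. q < z p \<and> p < z q}"
proof (intro set_eqI iffI)
  have yq: "y q = p" using pq y by auto
  {
    fix z assume "z \<in> Psi_plus y q"
    then obtain j where j: "q < j" "z = conj_transp q j y" "bruhat_cover y z" unfolding Psi_plus_def by blast
    have c: "z \<in> covers y" using j bruhat_cover_iff[OF y] by simp
    then have "flen y < flen (conj_transp q j y)" unfolding covers_def j(2)[symmetric] by simp
    then have "y q < y j" unfolding flen_conj_less_iff[OF y j(1)] .
    then have k: "p < y j" using yq by simp
    have "y j \<noteq> q"
    proof
      assume "y j = q"
      then have "j = y q" using F_Z_invol[OF y, of j] by simp
      then show False using yq pq(2) j(1) by simp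
    qed
    then have n: "y j \<noteq> j" "y j \<noteq> q" using F_Z_neq[OF y, of j] by simp_all
    have "z p = j" "z q = y j" unfolding j(2) conj_transp_apply using pq j(1) n by auto
    with c k j(1) show "z \<in> {z \<in> {z \<in> covers y. z p \<noteq> q}. q < z p \<and> p < z q}" by simp
  next
    fix z assume z: "z \<in> {z \<in> {z \<in> covers y. z p \<noteq> q}. q < z p \<and> p < z q}"
    then have c: "z \<in> covers y" "z p \<noteq> y p" "q < z p" using pq by auto
    then have "z = conj_transp q (z p) y"
      using conj_transp_moved[OF y] pq(1) unfolding covers_def by blast
    moreover from this have "bruhat_cover y z" using bruhat_cover_iff[OF y, of q "z p"] c(1) by simp
    ultimately show "z \<in> Psi_plus y q" unfolding Psi_plus_def using c covers_F_Z[OF y] by blast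
  }
qed

lemma Psi_minus_eq:
  assumes y: "y \<in> F_Z" and pq: "y p = q" "p < q"
  shows "Psi_minus y p = {z \<in> {z \<in> covers y. z p \<noteq> q}. z p < q \<and> z q < p}"
proof (intro set_eqI iffI)
  have yq: "y q = p" using pq y by auto
  {
    fix z assume "z \<in> Psi_minus y p"
    then obtain i where i: "i < p" "z = conj_transp i p y" "bruhat_cover y z" unfolding Psi_minus_def by blast
    have c: "z \<in> covers y" using i bruhat_cover_iff[OF y] by simp
    then have "flen y < flen (conj_transp i p y)" unfolding covers_def i(2)[symmetric] by simp
    then have "y i < y p" unfolding flen_conj_less_iff[OF y i(1)] .
    then have k: "y i < q" using pq by simp
    have "y i \<noteq> p"
    proof
      assume "y i = p"
      then have "i = y p" using F_Z_invol[OF y, of i] by simp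
      then show False using pq i(1) by simp
    qed
    then have n: "y i \<noteq> i" "y i \<noteq> p" using F_Z_neq[OF y, of i] by simp_all
    have "z q = i" "z p = y i" unfolding i(2) conj_transp_apply using pq yq i(1) n by auto
    with c k i(1) show "z \<in> {z \<in> {z \<in> covers y. z p \<noteq> q}. z p < q \<and> z q < p}" by simp
  next
    fix z assume z: "z \<in> {z \<in> {z \<in> covers y. z p \<noteq> q}. z p < q \<and> z q < p}"
    then have c: "z \<in> covers y" "z q \<noteq> y q" "z q < p" using yq by auto
    then have "z = conj_transp (z q) p y"
      using conj_transp_moved[OF y] yq unfolding covers_def conj_transp_commute[of _ p] by blast
    moreover from this have "bruhat_cover y z" using bruhat_cover_iff[OF y, of "z q" p] c(1) by simp
    ultimately show "z \<in> Psi_minus y p" unfolding Psi_minus_def using c covers_F_Z[OF y] by blast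
  }
qed

theorem theorem4p17:
  fixes y :: "int \<Rightarrow> int" and p q :: int
  assumes "y \<in> F_inf" and "(p, q) \<in> Cyc_P y"
  shows "(X p + X q) * fpf_schubert y =
    (\<Sum>z\<in>Psi_plus y q. fpf_schubert z) - (\<Sum>z\<in>Psi_minus y p. fpf_schubert z)"
proof -
  have y: "y \<in> F_Z" by (rule F_inf_F_Z[OF assms(1)])
  have yp: "y p = q" and p: "1 \<le> p" and "p \<le> q" using assms(2) unfolding Cyc_P_def Cyc_Z_def by auto
  then have pq: "p < q" using F_Z_neq[OF y, of p] by simp
  have yq: "y q = p" using yp y by auto
  let ?K = "{z \<in> covers y. z p \<noteq> q}" and ?S = "fpf_schubert"
  have fin: "finite ?K" using finite_covers_moved[OF y, of p] yp by simp
  have Kq: "{z \<in> covers y. z q \<noteq> y q} = ?K"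
  proof -
    have "z q = p \<longleftrightarrow> z p = q" if "z \<in> covers y" for z
      using F_Z_eq_iff[OF covers_F_Z[OF y that], of q p] by auto
    then show ?thesis unfolding yq by blast
  qed
  have summand: "of_int (sgn (z p - q)) * ?S z + of_int (sgn (z q - p)) * ?S z
      = of_int 2 * ((if q < z p \<and> p < z q then ?S z else 0) - (if z p < q \<and> z q < p then ?S z else 0))"
    if "z \<in> ?K" for z
  proof -
    have "z \<in> {z \<in> covers y. z q \<noteq> y q}" unfolding Kq by (rule that)
    then have "z q \<noteq> p" by (simp add: yq)
    moreover have "z p \<noteq> q" using that by simp
    ultimately have sgn_eq: "sgn (z p - q) + sgn (z q - p)
        = 2 * ((if q < z p \<and> p < z q then 1 else 0) - (if z p < q \<and> z q < p then 1 else 0))"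
      by (simp add: sgn_if)
    have if_eq: "(if A then ?S z else 0) - (if B then ?S z else 0)
        = of_int ((if A then 1 else 0) - (if B then 1 else 0)) * ?S z" for A B
      by (cases A; cases B) simp_all
    show ?thesis
      unfolding if_eq distrib_right[symmetric] of_int_add[symmetric] sgn_eq
      by (simp only: of_int_mult mult.assoc)
  qed
  have "of_int 2 * ((X p + X q) * ?S y) = cover_sum y p + cover_sum y q"
    using doubled_transition[OF assms(1) p] by (simp only: yp)
  also have "\<dots> = (\<Sum>z\<in>?K. of_int (sgn (z p - q)) * ?S z + of_int (sgn (z q - p)) * ?S z)"
    unfolding cover_sum_def Kq sum.distrib by (simp only: yp yq)
  also have "\<dots> = (\<Sum>z\<in>?K. of_int 2 * ((if q < z p \<and> p < z q then ?S z else 0)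
      - (if z p < q \<and> z q < p then ?S z else 0)))"
    by (rule sum.cong[OF refl summand])
  also have "\<dots> = of_int 2 * ((\<Sum>z\<in>Psi_plus y q. ?S z) - (\<Sum>z\<in>Psi_minus y p. ?S z))"
    unfolding sum_distrib_left[symmetric] sum_subtractf
      Psi_plus_eq[OF y yp pq] Psi_minus_eq[OF y yp pq] sum.inter_filter[OF fin] ..
  finally have doubled: "of_int 2 * ((X p + X q) * ?S y)
      = of_int 2 * ((\<Sum>z\<in>Psi_plus y q. ?S z) - (\<Sum>z\<in>Psi_minus y p. ?S z))" .
  have "(of_int 2 :: zpoly) \<noteq> 0" unfolding of_int_eq_0_iff by simp
  from mult_left_cancel[OF this] doubled show ?thesis by (rule iffD1)
qed

end
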